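(* Let $m',n'$ be cardinals, let $H$ be a group, and let $\mathcal{H}$ be an $H$-regular $1$-factorization of $K_{m'}[n']$. Let $m,n$ be cardinals such that $mn$ is infinite, $m'\mid m$ and $n'\mid n$. Then there exists a regular $1$-factorization of $K_m[n]$ containing $\mathcal{H}$ as a subfactorization.
   Context: $K_m[n]$ is the complete equipartite graph with $m$ parts of size $n$. For cardinals $a,b$, $a\mid b$ means: either $b$ is infinite and $a\le b$, or $b$ is finite and $a$ divides $b$. A $1$-factor of a graph is a spanning subgraph in which every vertex has degree exactly $1$; a $1$-factorization is a set of $1$-factors whose edge sets partition the edge set. A $1$-factorization is $G$-regular if it has an automorphism group (bijections of the vertex set mapping each factor to a factor) isomorphic to $G$ acting sharply transitively on the vertices; "regular" means $G$-regular for some group $G$. A $1$-factorization $\mathcal{G}$ of a graph containing (an isomorphic copy of) $K_{m'}[n']$ as a subgraph contains $\mathcal{H}$ as a subfactorization if for every $F\in\mathcal{H}$ and $\Gamma\in\mathcal{G}$, either $F\subseteq\Gamma$ or $F$ and $\Gamma$ share no edge. *)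

theory Defs
  imports "HOL-Algebra.Bij" "HOL-Library.Equipollence" "HOL-Library.Disjoint_Sets"
begin

text \<open>
  A graph is given by a vertex set \<open>V\<close> and a set \<open>E\<close> of edges, each edge being the set of its two
  end points.  A spanning subgraph of it is identified with its edge set.

  A cardinal is represented by any set having that cardinality.
\<close>

definition cardinal_dvd :: "'a set \<Rightarrow> 'b set \<Rightarrow> bool" where
  "cardinal_dvd A B \<longleftrightarrow>
     (infinite B \<and> A \<lesssim> B) \<or> (finite B \<and> finite A \<and> card A dvd card B)"

text \<open>
  The graph \<open>K\<^sub>m[n]\<close> for \<open>m = |I|\<close> and \<open>n = |J|\<close>: its parts are the sets \<open>{i} \<times> J\<close> with \<open>i \<in> I\<close>.
\<close>

definition equipartite_verts :: "'a set \<Rightarrow> 'b set \<Rightarrow> ('a \<times> 'b) set" where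
  "equipartite_verts I J = I \<times> J"

definition equipartite_edges :: "'a set \<Rightarrow> 'b set \<Rightarrow> ('a \<times> 'b) set set" where
  "equipartite_edges I J =
     {{(i, x), (j, y)} | i x j y. i \<in> I \<and> j \<in> I \<and> i \<noteq> j \<and> x \<in> J \<and> y \<in> J}"

definition one_factor :: "'v set \<Rightarrow> 'v set set \<Rightarrow> 'v set set \<Rightarrow> bool" where
  "one_factor V E F \<longleftrightarrow> F \<subseteq> E \<and> (\<forall>v\<in>V. card {e \<in> F. v \<in> e} = 1)"

definition one_factorization :: "'v set \<Rightarrow> 'v set set \<Rightarrow> 'v set set set \<Rightarrow> bool" where
  "one_factorization V E \<F> \<longleftrightarrow> (\<forall>F\<in>\<F>. one_factor V E F) \<and> partition_on E \<F>"

definition map_edges :: "('v \<Rightarrow> 'w) \<Rightarrow> 'v set set \<Rightarrow> 'w set set" where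
  "map_edges f F = (\<lambda>e. f ` e) ` F"

definition automorphism_group :: "'v set \<Rightarrow> 'v set set set \<Rightarrow> ('v \<Rightarrow> 'v) set \<Rightarrow> bool" where
  "automorphism_group V \<F> A \<longleftrightarrow>
     subgroup A (BijGroup V) \<and> (\<forall>f\<in>A. \<forall>F\<in>\<F>. map_edges f F \<in> \<F>)"

definition sharply_transitive :: "'v set \<Rightarrow> ('v \<Rightarrow> 'v) set \<Rightarrow> bool" where
  "sharply_transitive V A \<longleftrightarrow> (\<forall>x\<in>V. \<forall>y\<in>V. \<exists>!f. f \<in> A \<and> f x = y)"

definition group_regular :: "('g, 'c) monoid_scheme \<Rightarrow> 'v set \<Rightarrow> 'v set set set \<Rightarrow> bool" where
  "group_regular G V \<F> \<longleftrightarrow>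
     (\<exists>A. automorphism_group V \<F> A \<and> sharply_transitive V A \<and>
          (BijGroup V)\<lparr>carrier := A\<rparr> \<cong> G)"

text \<open>
  Fixing the type of the group \<open>G\<close> below loses no generality: whatever the type of its elements,
  \<open>G\<close> is isomorphic to a group of permutations of \<open>V\<close>.
\<close>

definition regular :: "'v set \<Rightarrow> 'v set set set \<Rightarrow> bool" where
  "regular V \<F> \<longleftrightarrow> (\<exists>G :: ('v \<Rightarrow> 'v) monoid. group G \<and> group_regular G V \<F>)"

text \<open>The image of such a map is a subgraph, not necessarily induced, isomorphic to \<open>(V', E')\<close>.\<close>

definition subgraph_embedding ::
    "('v \<Rightarrow> 'w) \<Rightarrow> 'v set \<Rightarrow> 'v set set \<Rightarrow> 'w set \<Rightarrow> 'w set set \<Rightarrow> bool" where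
  "subgraph_embedding \<phi> V' E' V E \<longleftrightarrow>
     inj_on \<phi> V' \<and> \<phi> ` V' \<subseteq> V \<and> map_edges \<phi> E' \<subseteq> E"

definition contains_subfactorization ::
    "'w set \<Rightarrow> 'w set set \<Rightarrow> 'w set set set \<Rightarrow> 'v set \<Rightarrow> 'v set set \<Rightarrow> 'v set set set \<Rightarrow> bool" where
  "contains_subfactorization V E \<G> V' E' \<H> \<longleftrightarrow>
     (\<exists>\<phi>. subgraph_embedding \<phi> V' E' V E \<and>
          (\<forall>F\<in>\<H>. \<forall>\<Gamma>\<in>\<G>. map_edges \<phi> F \<subseteq> \<Gamma> \<or> map_edges \<phi> F \<inter> \<Gamma> = {}))"

end

theory Submission
  imports Defs "HOL-Algebra.Free_Abelian_Groups" "HOL-Algebra.Weak_Morphisms"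
begin

text \<open>
  The regular action turns the vertex set of \<open>K\<^sub>m\<^sub>'[n']\<close> into a group \<open>G\<close> whose left translations preserve
  \<open>\<H>\<close>. Writing \<open>m = m'k\<close> and \<open>n = n'l\<close>, the vertex set of \<open>K\<^sub>m[n]\<close> becomes the group \<open>G \<times> K \<times> L\<close> with
  \<open>|K| = k\<close> and \<open>|L| = l\<close>. Copying each factor of \<open>\<H>\<close> into all cosets of \<open>G\<close> takes care of the edges inside
  these cosets. The other edges form a Cayley graph. An involution in its connection set contributes
  an invariant \<open>1\<close>-factor. The remaining connection elements, if there are any, are as numerous as the
  group, because the larger of \<open>K\<close> and \<open>L\<close> is chosen to be an infinite elementary abelian \<open>2\<close>-group. A
  transfinite greedy construction then gives a single perfect matching realizing each of their
  differences exactly once, and its translates are the remaining factors.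
\<close>

section \<open>Transfinite construction of a matching\<close>

unbundle cardinal_syntax

text \<open>
  The element meeting requirement \<open>\<alpha>\<close> is chosen by recursion along a well-order of \<open>C\<close> of minimal
  type, so that fewer than \<open>|C|\<close> elements have been chosen before it.
\<close>

lemma transfinite_greedy:
  assumes "symp indep"
    and step: "\<And>\<alpha> P. \<lbrakk>\<alpha> \<in> C; P \<subseteq> X; |P| <o |C|; pairwise indep P\<rbrakk>
                 \<Longrightarrow> \<exists>x\<in>X. req \<alpha> x \<and> (\<forall>y\<in>P. y \<noteq> x \<longrightarrow> indep x y)"
  shows "\<exists>P\<subseteq>X. pairwise indep P \<and> (\<forall>\<alpha>\<in>C. \<exists>x\<in>P. req \<alpha> x)"
proof -
  have wo: "Well_order |C|" and fld: "Field |C| = C"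
    by simp_all
  have wf: "wf ( |C| - Id)"
    using wo by (simp add: well_order_on_def)
  \<comment> \<open>The clause \<open>y \<noteq> x\<close> lets a stage return an element chosen
    earlier if that one already meets the new requirement, so \<open>p\<close> need not be
    injective.\<close>
  define ok where "ok \<alpha> P x \<longleftrightarrow> x \<in> X \<and> req \<alpha> x \<and> (\<forall>y\<in>P. y \<noteq> x \<longrightarrow> indep x y)" for \<alpha> P x
  define p where "p = wfrec ( |C| - Id) (\<lambda>p \<alpha>. SOME x. ok \<alpha> (p ` underS |C| \<alpha>) x)"
  have p: "p \<alpha> = (SOME x. ok \<alpha> (p ` underS |C| \<alpha>) x)" for \<alpha>
  proof -
    have "cut p ( |C| - Id) \<alpha> ` underS |C| \<alpha> = p ` underS |C| \<alpha>"
      by (intro image_cong) (auto simp: cut_def underS_def)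
    then show ?thesis
      using wfrec[OF wf, of "\<lambda>p \<alpha>. SOME x. ok \<alpha> (p ` underS |C| \<alpha>) x" \<alpha>]
      unfolding p_def[symmetric] by simp
  qed
  have lin: "\<alpha> \<in> underS |C| \<beta> \<or> \<beta> \<in> underS |C| \<alpha>" if "\<alpha> \<in> C" "\<beta> \<in> C" "\<alpha> \<noteq> \<beta>" for \<alpha> \<beta>
    using wo that fld by (auto simp: well_order_on_def linear_order_on_def total_on_def underS_def)
  have sub: "underS |C| \<alpha> \<subseteq> C" for \<alpha>
    using fld by (auto simp: underS_def Field_def)
  \<comment> \<open>Used twice: for proper initial segments, where the hypothesis
    \<open>step\<close> asks for independence of the earlier choices, and for all of
    \<open>C\<close> at the end.\<close>
  have pw: "pairwise indep (p ` D)"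
    if "D \<subseteq> C" "\<And>\<alpha>. \<alpha> \<in> D \<Longrightarrow> ok \<alpha> (p ` underS |C| \<alpha>) (p \<alpha>)" for D
  proof (rule pairwiseI, elim imageE, clarify)
    fix \<alpha> \<beta> assume *: "\<alpha> \<in> D" "\<beta> \<in> D" "p \<alpha> \<noteq> p \<beta>"
    then have "\<alpha> \<in> underS |C| \<beta> \<or> \<beta> \<in> underS |C| \<alpha>"
      using lin that(1) by blast
    then have "indep (p \<alpha>) (p \<beta>) \<or> indep (p \<beta>) (p \<alpha>)"
      using that(2) * by (fastforce simp: ok_def)
    then show "indep (p \<alpha>) (p \<beta>)"
      using \<open>symp indep\<close> by (auto dest: sympD)
  qed
  have ok: "\<alpha> \<in> C \<longrightarrow> ok \<alpha> (p ` underS |C| \<alpha>) (p \<alpha>)" for \<alpha>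
  proof (induction \<alpha> rule: wf_induct_rule[OF wf])
    case (1 \<alpha>)
    then have IH: "ok \<beta> (p ` underS |C| \<beta>) (p \<beta>)" if "\<beta> \<in> underS |C| \<alpha>" for \<beta>
      using that sub by (auto simp: underS_def)
    show ?case
    proof
      assume "\<alpha> \<in> C"
      have "|p ` underS |C| \<alpha>| \<le>o |underS |C| \<alpha>|"
        by (rule card_of_image)
      moreover have "|underS |C| \<alpha>| <o |C|"
        using \<open>\<alpha> \<in> C\<close> fld by (intro card_of_underS) auto
      ultimately have "|p ` underS |C| \<alpha>| <o |C|"
        by (rule ordLeq_ordLess_trans)
      then have "\<exists>x. ok \<alpha> (p ` underS |C| \<alpha>) x"
        using step[OF \<open>\<alpha> \<in> C\<close>, of "p ` underS |C| \<alpha>"] IH pw[OF sub] by (auto simp: ok_def)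
      then show "ok \<alpha> (p ` underS |C| \<alpha>) (p \<alpha>)"
        unfolding p[of \<alpha>] by (rule someI_ex)
    qed
  qed
  show ?thesis
    using pw[of C] ok by (intro exI[of _ "p ` C"]) (auto simp: ok_def)
qed

text \<open>A pair \<open>(d, x)\<close> stands for the edge joining \<open>x\<close> to
  \<open>s d x\<close>. Serving every label in \<open>R\<close> and covering every vertex amounts to
  only \<open>|V|\<close> requirements, and at each stage fewer than \<open>|V|\<close> vertices are
  occupied. Injectivity of \<open>s\<close> in each argument bounds the forbidden choices by the
  occupied vertices, so a free choice always remains.\<close>

lemma pairs_cover_exists:
  fixes s :: "'d \<Rightarrow> 'v \<Rightarrow> 'v"
  assumes "infinite V" and RV: "R \<approx> V"
    and mem: "\<And>d x. \<lbrakk>d \<in> R; x \<in> V\<rbrakk> \<Longrightarrow> s d x \<in> V"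
    and inj1: "\<And>d. d \<in> R \<Longrightarrow> inj_on (s d) V"
    and inj2: "\<And>x. x \<in> V \<Longrightarrow> inj_on (\<lambda>d. s d x) R"
  shows "\<exists>f. f \<in> R \<rightarrow> V \<and> (\<forall>v\<in>V. \<exists>d\<in>R. v \<in> {f d, s d (f d)}) \<and>
           (\<forall>d\<in>R. \<forall>d'\<in>R. d \<noteq> d' \<longrightarrow> {f d, s d (f d)} \<inter> {f d', s d' (f d')} = {})"
proof -
  define ends where "ends p = {snd p, s (fst p) (snd p)}" for p
  \<comment> \<open>Demanding distinct labels besides disjoint ends makes the final set of pairs the
    graph of a function on \<open>R\<close>.\<close>
  define indep where "indep p q \<longleftrightarrow> fst p \<noteq> fst q \<and> ends p \<inter> ends q = {}" for p q
  \<comment> \<open>\<open>Inl d\<close> asks for a pair belonging to \<open>d\<close>, and \<open>Inr v\<close> for a pair covering \<open>v\<close>.\<close>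
  define req where "req \<alpha> p \<longleftrightarrow> (case \<alpha> of Inl d \<Rightarrow> fst p = d | Inr v \<Rightarrow> v \<in> ends p)" for \<alpha> p
  have RV': "|R| =o |V|"
    using RV by (simp add: eqpoll_iff_card_of_ordIso)
  have "infinite R"
    using RV \<open>infinite V\<close> eqpoll_finite_iff by blast
  have "|R <+> V| =o |V|"
    using card_of_Plus_infinite2[OF \<open>infinite V\<close>] RV' ordIso_iff_ordLeq by blast
  have "\<exists>P\<subseteq>R \<times> V. pairwise indep P \<and> (\<forall>\<alpha>\<in>R <+> V. \<exists>p\<in>P. req \<alpha> p)"
  proof (rule transfinite_greedy)
    show "symp indep"
      by (auto simp: indep_def symp_def)
  next
    fix \<alpha> P
    assume \<alpha>: "\<alpha> \<in> R <+> V" and P: "P \<subseteq> R \<times> V" "|P| <o |R <+> V|" "pairwise indep P"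
    have PV: "|P| <o |V|"
      using P(2) \<open>|R <+> V| =o |V|\<close> ordLess_ordIso_trans by blast
    define U where "U = snd ` P \<union> (\<lambda>p. s (fst p) (snd p)) ` P"
    have U: "ends p \<subseteq> U" if "p \<in> P" for p
      using that by (auto simp: U_def ends_def)
    have small: "|f ` P| <o |V|" for f :: "'d \<times> 'v \<Rightarrow> 'w"
      using card_of_image PV ordLeq_ordLess_trans by blast
    have UV: "|U| <o |V|"
      unfolding U_def by (intro card_of_Un_ordLess_infinite \<open>infinite V\<close> small)
    show "\<exists>p\<in>R \<times> V. req \<alpha> p \<and> (\<forall>q\<in>P. q \<noteq> p \<longrightarrow> indep p q)"
    proof (cases "\<exists>p\<in>P. req \<alpha> p")
      case True
      then show ?thesis
        using P by (fastforce simp: pairwise_def)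
    next
      case new: False
      show ?thesis
      proof (cases \<alpha>)
        case (Inl d)
        then have "d \<in> R"
          using \<alpha> by auto
        \<comment> \<open>The label is fixed and the starting point varies: \<open>B\<close> holds
          the starting points whose other end is occupied.\<close>
        define B where "B = {x \<in> V. s d x \<in> U}"
        have "inj_on (s d) B" "s d ` B \<subseteq> U"
          using inj1[OF \<open>d \<in> R\<close>] by (auto simp: B_def inj_on_def)
        then have "|B| \<le>o |U|"
          using card_of_ordLeq by blast
        then have "|U \<union> B| <o |V|"
          using UV \<open>infinite V\<close> card_of_Un_ordLess_infinite ordLeq_ordLess_trans by blast
        then have "\<not> V \<subseteq> U \<union> B"
          using card_of_mono1 not_ordLess_ordLeq by blast
        then obtain x where x: "x \<in> V" "x \<notin> U" "x \<notin> B"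
          by blast
        have "indep (d, x) q" if "q \<in> P" for q
          using new U[OF that] that x Inl by (auto simp: indep_def req_def ends_def B_def)
        then show ?thesis
          using \<open>d \<in> R\<close> x Inl by (intro bexI[of _ "(d, x)"]) (auto simp: req_def)
      next
        case (Inr v)
        then have "v \<in> V"
          using \<alpha> by auto
        define B where "B = {d \<in> R. s d v \<in> U}"
        have "inj_on (\<lambda>d. s d v) B" "(\<lambda>d. s d v) ` B \<subseteq> U"
          using inj2[OF \<open>v \<in> V\<close>] by (auto simp: B_def inj_on_def)
        then have "|B| \<le>o |U|"
          using card_of_ordLeq by blast
        then have "|fst ` P \<union> B| <o |V|"
          using UV \<open>infinite V\<close> card_of_Un_ordLess_infinite ordLeq_ordLess_trans small by blast
        then have "|fst ` P \<union> B| <o |R|"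
          using RV' ordIso_symmetric ordLess_ordIso_trans by blast
        then have "\<not> R \<subseteq> fst ` P \<union> B"
          using card_of_mono1 not_ordLess_ordLeq by blast
        then obtain d where d: "d \<in> R" "d \<notin> fst ` P" "d \<notin> B"
          by blast
        have "v \<notin> U"
          using new Inr by (auto simp: U_def req_def ends_def)
        then have "indep (d, v) q" if "q \<in> P" for q
          using U[OF that] that d by (auto simp: indep_def ends_def B_def)
        then show ?thesis
          using \<open>v \<in> V\<close> d Inr by (intro bexI[of _ "(d, v)"]) (auto simp: req_def ends_def)
      qed
    qed
  qed
  then obtain P where P: "P \<subseteq> R \<times> V" "pairwise indep P" "\<And>\<alpha>. \<alpha> \<in> R <+> V \<Longrightarrow> \<exists>p\<in>P. req \<alpha> p"
    by blast
  have "\<exists>x. (d, x) \<in> P" if "d \<in> R" for d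
    using P(3)[OF InlI[OF that]] by (force simp: req_def)
  then obtain f where f: "\<And>d. d \<in> R \<Longrightarrow> (d, f d) \<in> P"
    by metis
  have f_unique: "p = (fst p, f (fst p))" if "p \<in> P" for p
  proof -
    have "(fst p, f (fst p)) \<in> P"
      using f[of "fst p"] P(1) that by auto
    then show ?thesis
      using P(2) that unfolding pairwise_def indep_def by (metis fst_conv)
  qed
  show ?thesis
  proof (intro exI[of _ f] conjI ballI impI)
    show "f \<in> R \<rightarrow> V"
      using f P(1) by auto
  next
    fix v assume "v \<in> V"
    then obtain p where "p \<in> P" "v \<in> ends p"
      using P(3)[OF InrI] by (force simp: req_def)
    then show "\<exists>d\<in>R. v \<in> {f d, s d (f d)}"
      using f_unique[of p] P(1) unfolding ends_def by (metis SigmaD1 snd_conv subsetD)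
  next
    fix d d' assume "d \<in> R" "d' \<in> R" "d \<noteq> d'"
    then have "indep (d, f d) (d', f d')"
      using f P(2) by (auto simp: pairwise_def)
    then show "{f d, s d (f d)} \<inter> {f d', s d' (f d')} = {}"
      by (simp add: indep_def ends_def)
  qed
qed

section \<open>Translation-invariant \<open>1\<close>-factorizations of Cayley graphs\<close>

lemma one_factorizationI:
  assumes "\<Union>\<F> = E" and "{} \<notin> \<F>"
    and "\<And>F F' e. \<lbrakk>F \<in> \<F>; F' \<in> \<F>; e \<in> F; e \<in> F'\<rbrakk> \<Longrightarrow> F = F'"
    and "\<And>F v. \<lbrakk>F \<in> \<F>; v \<in> V\<rbrakk> \<Longrightarrow> \<exists>!e. e \<in> F \<and> v \<in> e"
  shows "one_factorization V E \<F>"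
proof -
  have "card {e \<in> F. v \<in> e} = 1" if Fv: "F \<in> \<F>" "v \<in> V" for F v
  proof -
    obtain e where "\<And>e'. e' \<in> F \<and> v \<in> e' \<longleftrightarrow> e' = e"
      using assms(4)[OF Fv] by metis
    then have "{e \<in> F. v \<in> e} = {e}"
      by auto
    then show ?thesis
      by simp
  qed
  moreover have "disjoint \<F>"
    using assms(3) by (fastforce simp: disjoint_def)
  ultimately show ?thesis
    using assms(1,2) by (auto simp: one_factorization_def one_factor_def partition_on_def)
qed

lemma one_factorizationD:
  assumes "one_factorization V E \<F>"
  shows "\<Union>\<F> = E" and "{} \<notin> \<F>"
    and "\<lbrakk>F \<in> \<F>; F' \<in> \<F>; e \<in> F; e \<in> F'\<rbrakk> \<Longrightarrow> F = F'"
    and "\<lbrakk>F \<in> \<F>; v \<in> V\<rbrakk> \<Longrightarrow> \<exists>!e. e \<in> F \<and> v \<in> e"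
proof -
  have *: "\<Union>\<F> = E \<and> {} \<notin> \<F> \<and> disjoint \<F>"
    using assms by (auto simp: one_factorization_def partition_on_def)
  then show "\<Union>\<F> = E" "{} \<notin> \<F>"
    by auto
  show "\<lbrakk>F \<in> \<F>; F' \<in> \<F>; e \<in> F; e \<in> F'\<rbrakk> \<Longrightarrow> F = F'"
    using * unfolding disjoint_def by blast
  assume "F \<in> \<F>" "v \<in> V"
  then have "card {e \<in> F. v \<in> e} = 1"
    using assms by (auto simp: one_factorization_def one_factor_def)
  then obtain e where "{e \<in> F. v \<in> e} = {e}"
    by (auto simp: card_1_singleton_iff)
  then show "\<exists>!e. e \<in> F \<and> v \<in> e"
    by (intro ex1I[of _ e]) auto
qed

lemma one_factorization_Un:
  assumes "one_factorization V E \<F>" "one_factorization V E' \<F>'" "E \<inter> E' = {}"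
  shows "one_factorization V (E \<union> E') (\<F> \<union> \<F>')"
proof (rule one_factorizationI)
  note D = one_factorizationD[OF assms(1)] and D' = one_factorizationD[OF assms(2)]
  show "\<Union>(\<F> \<union> \<F>') = E \<union> E'" "{} \<notin> \<F> \<union> \<F>'"
    using D(1,2) D'(1,2) by auto
  show "\<exists>!e. e \<in> F \<and> v \<in> e" if "F \<in> \<F> \<union> \<F>'" "v \<in> V" for F v
    using that D(4) D'(4) by blast
  fix F F' e assume *: "F \<in> \<F> \<union> \<F>'" "F' \<in> \<F> \<union> \<F>'" "e \<in> F" "e \<in> F'"
  have "F \<in> \<F> \<and> F' \<in> \<F> \<or> F \<in> \<F>' \<and> F' \<in> \<F>'"
    using * D(1) D'(1) assms(3) by blast
  then show "F = F'"
    using * D(3) D'(3) by metis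
qed

section \<open>Left translations and Cayley edge sets\<close>

definition translation_invariant ::
    "('g, 'c) monoid_scheme \<Rightarrow> 'g set set set \<Rightarrow> bool" where
  "translation_invariant G \<F> \<longleftrightarrow> (\<forall>g\<in>carrier G. \<forall>F\<in>\<F>. map_edges (mult G g) F \<in> \<F>)"

definition invariant_edges :: "('g, 'c) monoid_scheme \<Rightarrow> 'g set set \<Rightarrow> bool" where
  "invariant_edges G E \<longleftrightarrow> (\<forall>g\<in>carrier G. \<forall>e\<in>E. mult G g ` e \<in> E)"

text \<open>The connection element acts from the right, so it commutes with left translations.
  \<open>S\<close> need not be closed under inverses: \<open>s\<close> and its inverse yield the
  same edges, which is why half of a connection set suffices later.\<close>

definition cayley_edges :: "('g, 'c) monoid_scheme \<Rightarrow> 'g set \<Rightarrow> 'g set set" where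
  "cayley_edges G S = {{x, x \<otimes>\<^bsub>G\<^esub> s} | x s. x \<in> carrier G \<and> s \<in> S}"

lemma translation_invariant_Un:
  "\<lbrakk>translation_invariant G \<F>; translation_invariant G \<F>'\<rbrakk> \<Longrightarrow> translation_invariant G (\<F> \<union> \<F>')"
  by (auto simp: translation_invariant_def)

context group
begin

lemma mult_mult_inv [simp]:
  "\<lbrakk>x \<in> carrier G; y \<in> carrier G\<rbrakk> \<Longrightarrow> x \<otimes> y \<otimes> inv y = x"
  "\<lbrakk>x \<in> carrier G; y \<in> carrier G\<rbrakk> \<Longrightarrow> x \<otimes> inv y \<otimes> y = x"
  "\<lbrakk>x \<in> carrier G; y \<in> carrier G\<rbrakk> \<Longrightarrow> x \<otimes> (inv x \<otimes> y) = y"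
  "\<lbrakk>x \<in> carrier G; y \<in> carrier G\<rbrakk> \<Longrightarrow> inv x \<otimes> (x \<otimes> y) = y"
  by (simp_all add: m_assoc) (simp_all add: m_assoc[symmetric])

lemma map_edges_mult_mult:
  assumes "g \<in> carrier G" "h \<in> carrier G" "\<And>e. e \<in> F \<Longrightarrow> e \<subseteq> carrier G"
  shows "map_edges (mult G g) (map_edges (mult G h) F) = map_edges (mult G (g \<otimes> h)) F"
proof -
  have "mult G g ` mult G h ` e = mult G (g \<otimes> h) ` e" if "e \<in> F" for e
    unfolding image_image using assms assms(3)[OF that]
    by (intro image_cong) (auto simp: m_assoc)
  then show ?thesis
    unfolding map_edges_def image_image[of "image (mult G g)"] by (rule image_cong[OF refl])
qed

text \<open>The source of disjointness for Cayley edge sets: either end of an edge may serve as base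
  point, and passing to the other end inverts the connection element.\<close>

lemma cayley_edge_eq:
  assumes "{x, x \<otimes> s} = {y, y \<otimes> t}" "x \<in> carrier G" "s \<in> carrier G" "y \<in> carrier G" "t \<in> carrier G"
  shows "x = y \<and> s = t \<or> y = x \<otimes> s \<and> t = inv s"
proof -
  from assms(1) consider "x = y" "x \<otimes> s = y \<otimes> t" | "x = y \<otimes> t" "x \<otimes> s = y"
    by (auto simp: doubleton_eq_iff)
  then show ?thesis
  proof cases
    case 1
    then show ?thesis
      using assms by simp
  next
    case 2
    then have "x = x \<otimes> s \<otimes> t"
      by simp
    then have "s \<otimes> t = \<one>"
      using assms by (simp add: m_assoc)
    then show ?thesis
      using 2 assms by (metis inv_equality inv_inv inv_closed)
  qed
qed

lemma invariant_cayley: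
  assumes "S \<subseteq> carrier G" "g \<in> carrier G"
  shows "map_edges (mult G g) (cayley_edges G S) = cayley_edges G S"
proof (intro equalityI subsetI)
  fix e assume "e \<in> map_edges (mult G g) (cayley_edges G S)"
  then obtain x s where "e = {g \<otimes> x, g \<otimes> (x \<otimes> s)}" "x \<in> carrier G" "s \<in> S"
    by (auto simp: map_edges_def cayley_edges_def)
  then have "e = {g \<otimes> x, (g \<otimes> x) \<otimes> s}" "g \<otimes> x \<in> carrier G" "s \<in> S"
    using assms by (auto simp: m_assoc)
  then show "e \<in> cayley_edges G S"
    by (auto simp: cayley_edges_def)
next
  fix e assume "e \<in> cayley_edges G S"
  then obtain x s where *: "e = {x, x \<otimes> s}" "x \<in> carrier G" "s \<in> S"
    by (auto simp: cayley_edges_def)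
  then have "s \<in> carrier G"
    using assms by auto
  then have "e = mult G g ` {inv g \<otimes> x, (inv g \<otimes> x) \<otimes> s}"
    using * assms by (simp add: m_assoc)
  moreover have "{inv g \<otimes> x, (inv g \<otimes> x) \<otimes> s} \<in> cayley_edges G S"
    using * assms by (auto simp: cayley_edges_def)
  ultimately show "e \<in> map_edges (mult G g) (cayley_edges G S)"
    unfolding map_edges_def by (rule image_eqI)
qed

text \<open>For a single \<open>s\<close> the edges \<open>{x, x \<otimes> s}\<close> are the left
  cosets of the subgroup \<open>{\<one>, s}\<close>. They therefore form a 1-factor, which every
  left translation maps to itself.\<close>

lemma involutions_one_factorization:
  assumes S: "S \<subseteq> carrier G" and inv: "\<And>s. s \<in> S \<Longrightarrow> s \<otimes> s = \<one>"
  shows "\<exists>\<F>. one_factorization (carrier G) (cayley_edges G S) \<F> \<and> translation_invariant G \<F>"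
proof (intro exI conjI)
  define \<F> where "\<F> = (\<lambda>s. cayley_edges G {s}) ` S"
  have inv': "inv s = s" if "s \<in> S" for s
    using inv[OF that] S that by (metis inv_equality subsetD)
  show "one_factorization (carrier G) (cayley_edges G S) \<F>"
  proof (rule one_factorizationI)
    show "\<Union>\<F> = cayley_edges G S"
      by (auto simp: \<F>_def cayley_edges_def)
    show "{} \<notin> \<F>"
      by (auto simp: \<F>_def cayley_edges_def)
  next
    fix F F' e assume "F \<in> \<F>" "F' \<in> \<F>" "e \<in> F" "e \<in> F'"
    then obtain s t where st: "s \<in> S" "t \<in> S" "F = cayley_edges G {s}" "F' = cayley_edges G {t}"
      by (auto simp: \<F>_def)
    moreover obtain x y where "e = {x, x \<otimes> s}" "e = {y, y \<otimes> t}" "x \<in> carrier G" "y \<in> carrier G"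
      using \<open>e \<in> F\<close> \<open>e \<in> F'\<close> st unfolding cayley_edges_def by blast
    ultimately show "F = F'"
      using cayley_edge_eq[of x s y t] inv' S by auto
  next
    fix F v assume "F \<in> \<F>" and v: "v \<in> carrier G"
    then obtain s where F: "s \<in> S" "F = cayley_edges G {s}"
      by (auto simp: \<F>_def)
    then have s: "s \<in> carrier G" "s \<otimes> s = \<one>"
      using S inv by auto
    show "\<exists>!e. e \<in> F \<and> v \<in> e"
    proof (rule ex1I[of _ "{v, v \<otimes> s}"])
      show "{v, v \<otimes> s} \<in> F \<and> v \<in> {v, v \<otimes> s}"
        using F v by (auto simp: cayley_edges_def)
    next
      fix e assume "e \<in> F \<and> v \<in> e"
      then obtain x where "e = {x, x \<otimes> s}" "x \<in> carrier G" "v = x \<or> v = x \<otimes> s"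
        using F by (auto simp: cayley_edges_def)
      then show "e = {v, v \<otimes> s}"
        using s by (auto simp: m_assoc)
    qed
  qed
  show "translation_invariant G \<F>"
    using invariant_cayley S by (auto simp: translation_invariant_def \<F>_def)
qed

text \<open>By \<open>half\<close>, an edge has at most one difference in \<open>R\<close>, read
  from only one of its ends; in particular the identity is not in \<open>R\<close>. Once a perfect
  matching has exactly one edge \<open>{f s, f s \<otimes> s}\<close> for each \<open>s\<close>, the
  edge \<open>{x, x \<otimes> s}\<close> lies in its translate by
  \<open>x \<otimes> inv (f s)\<close> and in no other.\<close>

lemma starter_one_factorization:
  assumes "infinite (carrier G)" and R: "R \<subseteq> carrier G" "R \<approx> carrier G"
    and half: "\<And>s. s \<in> R \<Longrightarrow> inv s \<notin> R"
  shows "\<exists>\<F>. one_factorization (carrier G) (cayley_edges G R) \<F> \<and> translation_invariant G \<F>"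
proof -
  have "\<exists>f. f \<in> R \<rightarrow> carrier G \<and> (\<forall>v\<in>carrier G. \<exists>s\<in>R. v \<in> {f s, f s \<otimes> s}) \<and>
          (\<forall>s\<in>R. \<forall>t\<in>R. s \<noteq> t \<longrightarrow> {f s, f s \<otimes> s} \<inter> {f t, f t \<otimes> t} = {})"
  proof (rule pairs_cover_exists[OF assms(1) R(2)])
    show "x \<otimes> s \<in> carrier G" if "s \<in> R" "x \<in> carrier G" for s x
      using R that by auto
    show "inj_on (\<lambda>x. x \<otimes> s) (carrier G)" if "s \<in> R" for s
      using R that by (auto simp: inj_on_def)
    show "inj_on (\<lambda>s. x \<otimes> s) R" if "x \<in> carrier G" for x
      using R that by (auto simp: inj_on_def subset_iff)
  qed
  then obtain f where f: "f \<in> R \<rightarrow> carrier G"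
    and cover: "\<And>v. v \<in> carrier G \<Longrightarrow> \<exists>s\<in>R. v \<in> {f s, f s \<otimes> s}"
    and disj: "\<And>s t. \<lbrakk>s \<in> R; t \<in> R; s \<noteq> t\<rbrakk> \<Longrightarrow> {f s, f s \<otimes> s} \<inter> {f t, f t \<otimes> t} = {}"
    by metis
  have f': "f s \<in> carrier G" if "s \<in> R" for s
    using f that by auto
  \<comment> \<open>Each \<open>s \<in> R\<close> is the difference of exactly one edge of \<open>M\<close>, so the translates of \<open>M\<close> are disjoint.\<close>
  define M where "M = (\<lambda>s. {f s, f s \<otimes> s}) ` R"
  have M: "e \<subseteq> carrier G" if "e \<in> M" for e
    using that f' R by (auto simp: M_def)
  define \<F> where "\<F> = (\<lambda>g. map_edges (mult G g) M) ` carrier G"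
  have edge: "e \<in> map_edges (mult G g) M \<longleftrightarrow> (\<exists>s\<in>R. e = {g \<otimes> f s, g \<otimes> f s \<otimes> s})"
    if "g \<in> carrier G" for g e
    using that f' R by (auto simp: map_edges_def M_def image_image m_assoc subset_iff)
  have "one_factorization (carrier G) (cayley_edges G R) \<F>"
  proof (rule one_factorizationI)
    show "\<Union>\<F> = cayley_edges G R"
    proof (intro equalityI subsetI)
      fix e assume "e \<in> \<Union>\<F>"
      then obtain g s where "g \<in> carrier G" "s \<in> R" "e = {g \<otimes> f s, g \<otimes> f s \<otimes> s}"
        using edge by (auto simp: \<F>_def)
      then show "e \<in> cayley_edges G R"
        using f' by (auto simp: cayley_edges_def)
    next
      fix e assume "e \<in> cayley_edges G R"
      then obtain x s where *: "e = {x, x \<otimes> s}" "x \<in> carrier G" "s \<in> R"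
        by (auto simp: cayley_edges_def)
      then have "e = {x \<otimes> inv (f s) \<otimes> f s, x \<otimes> inv (f s) \<otimes> f s \<otimes> s}"
        using f' by simp
      then have "e \<in> map_edges (mult G (x \<otimes> inv (f s))) M"
        using * f' by (subst edge) blast+
      then show "e \<in> \<Union>\<F>"
        using * f' by (auto simp: \<F>_def)
    qed
    show "{} \<notin> \<F>"
      using cover[OF one_closed] by (auto simp: \<F>_def M_def map_edges_def)
  next
    fix F F' e assume "F \<in> \<F>" "F' \<in> \<F>" "e \<in> F" "e \<in> F'"
    then obtain g h where gh: "g \<in> carrier G" "h \<in> carrier G"
      "F = map_edges (mult G g) M" "F' = map_edges (mult G h) M"
      by (auto simp: \<F>_def)
    then obtain s t where st: "s \<in> R" "t \<in> R" "e = {g \<otimes> f s, g \<otimes> f s \<otimes> s}" "e = {h \<otimes> f t, h \<otimes> f t \<otimes> t}"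
      using edge \<open>e \<in> F\<close> \<open>e \<in> F'\<close> by auto
    then have "g \<otimes> f s = h \<otimes> f t" "s = t"
      using cayley_edge_eq[of "g \<otimes> f s" s "h \<otimes> f t" t] half gh f' R by (auto simp: subset_iff)
    then show "F = F'"
      using gh f' st by simp
  next
    fix F v assume "F \<in> \<F>" and v: "v \<in> carrier G"
    then obtain g where g: "g \<in> carrier G" "F = map_edges (mult G g) M"
      by (auto simp: \<F>_def)
    \<comment> \<open>Pulling the vertex back by \<open>g\<close> reduces existence and uniqueness
      in a translate to \<open>cover\<close> and \<open>disj\<close> for the base matching.\<close>
    have split: "inv g \<otimes> v \<in> {f s, f s \<otimes> s} \<longleftrightarrow> v \<in> {g \<otimes> f s, g \<otimes> f s \<otimes> s}" if "s \<in> R" for s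
    proof -
      have "s \<in> carrier G" "f s \<in> carrier G"
        using that R f' by auto
      moreover have "inv g \<otimes> v = y \<longleftrightarrow> v = g \<otimes> y" if "y \<in> carrier G" for y
        using that g v by auto
      ultimately show ?thesis
        using g by (simp add: m_assoc)
    qed
    obtain s where s: "s \<in> R" "inv g \<otimes> v \<in> {f s, f s \<otimes> s}"
      using cover[of "inv g \<otimes> v"] g v by auto
    show "\<exists>!e. e \<in> F \<and> v \<in> e"
    proof (rule ex1I[of _ "{g \<otimes> f s, g \<otimes> f s \<otimes> s}"])
      show "{g \<otimes> f s, g \<otimes> f s \<otimes> s} \<in> F \<and> v \<in> {g \<otimes> f s, g \<otimes> f s \<otimes> s}"
        using s split edge g by auto
    next
      fix e assume "e \<in> F \<and> v \<in> e"
      then obtain t where "t \<in> R" "e = {g \<otimes> f t, g \<otimes> f t \<otimes> t}" "v \<in> {g \<otimes> f t, g \<otimes> f t \<otimes> t}"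
        using g edge by auto
      then show "e = {g \<otimes> f s, g \<otimes> f s \<otimes> s}"
        using disj[of s t] s split by blast
    qed
  qed
  moreover have "translation_invariant G \<F>"
    using map_edges_mult_mult M by (auto simp: translation_invariant_def \<F>_def)
  ultimately show ?thesis
    by blast
qed

section \<open>Invariant edge sets split by involutions\<close>

lemma exists_half_set:
  assumes "S \<subseteq> carrier G" "\<And>s. s \<in> S \<Longrightarrow> s \<otimes> s \<noteq> \<one>"
  shows "\<exists>R\<subseteq>S \<union> m_inv G ` S. S \<subseteq> R \<union> m_inv G ` R \<and> (\<forall>s\<in>R. inv s \<notin> R)"
proof -
  \<comment> \<open>The choice depends only on the set \<open>{s, inv s}\<close>, so
    \<open>s\<close> and \<open>inv s\<close> receive the same representative.\<close>
  define f where "f s = (SOME t. t \<in> {s, inv s})" for s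
  have f: "f s \<in> {s, inv s}" for s
    unfolding f_def by (rule someI[of _ s]) simp
  have f_inv: "f (inv s) = f s" if "s \<in> carrier G" for s
    using that by (simp add: f_def insert_commute)
  have "inv (f s) \<notin> f ` S" if "s \<in> S" for s
  proof
    have s: "s \<in> carrier G" "inv s \<noteq> s"
      using assms(1) assms(2)[OF \<open>s \<in> S\<close>] r_inv[of s] \<open>s \<in> S\<close> by fastforce+
    assume "inv (f s) \<in> f ` S"
    then obtain t where t: "t \<in> S" "inv (f s) = f t"
      by auto
    then have "t \<in> carrier G"
      using assms(1) by auto
    then have "t = f t \<or> t = inv (f t)"
      using f[of t] by auto
    moreover have "f s = s \<or> f s = inv s"
      using f[of s] by auto
    ultimately have "t \<in> {s, inv s}"
      unfolding t(2)[symmetric] using s(1) by auto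
    then have "f t = f s"
      using f_inv s by auto
    then show False
      using f[of s] t(2) s by auto
  qed
  moreover have "S \<subseteq> f ` S \<union> m_inv G ` f ` S"
  proof
    fix s assume "s \<in> S"
    then have "s = f s \<or> s = inv (f s)"
      using f[of s] assms(1) by auto
    then show "s \<in> f ` S \<union> m_inv G ` f ` S"
      using \<open>s \<in> S\<close> by blast
  qed
  moreover have "f ` S \<subseteq> S \<union> m_inv G ` S"
  proof (intro image_subsetI)
    show "f s \<in> S \<union> m_inv G ` S" if "s \<in> S" for s
      using f[of s] that by auto
  qed
  ultimately show ?thesis
    by (intro exI[of _ "f ` S"]) blast
qed

text \<open>Invariance reduces \<open>E\<close> to the neighbours of the identity. Involutions among
  them give one factor each; the others, halved, form the set \<open>R\<close> of a starter. A
  starter needs as many connection elements as the group has elements, unless there are none to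
  treat, whence the alternative in \<open>card\<close>.\<close>

lemma invariant_one_factorization:
  assumes "infinite (carrier G)"
    and inv: "invariant_edges G E"
    and E: "\<And>e. e \<in> E \<Longrightarrow> \<exists>x y. e = {x, y} \<and> x \<noteq> y \<and> x \<in> carrier G \<and> y \<in> carrier G"
    and card: "{s \<in> carrier G. {\<one>, s} \<in> E \<and> s \<otimes> s \<noteq> \<one>} = {} \<or>
               carrier G \<lesssim> {s \<in> carrier G. {\<one>, s} \<in> E \<and> s \<otimes> s \<noteq> \<one>}"
  shows "\<exists>\<F>. one_factorization (carrier G) E \<F> \<and> translation_invariant G \<F>"
proof -
  define S where "S = {s \<in> carrier G. {\<one>, s} \<in> E \<and> s \<otimes> s = \<one>}"
  define N where "N = {s \<in> carrier G. {\<one>, s} \<in> E \<and> s \<otimes> s \<noteq> \<one>}"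
  have edge: "{x, x \<otimes> s} \<in> E \<longleftrightarrow> {\<one>, s} \<in> E" if "x \<in> carrier G" "s \<in> carrier G" for x s
  proof
    assume "{x, x \<otimes> s} \<in> E"
    then have "mult G (inv x) ` {x, x \<otimes> s} \<in> E"
      using inv that unfolding invariant_edges_def by blast
    then show "{\<one>, s} \<in> E"
      using that by simp
  next
    assume "{\<one>, s} \<in> E"
    then have "mult G x ` {\<one>, s} \<in> E"
      using inv that unfolding invariant_edges_def by blast
    then show "{x, x \<otimes> s} \<in> E"
      using that by simp
  qed
  have N_inv: "inv s \<in> N" if "s \<in> N" for s
  proof -
    have s: "s \<in> carrier G" "{\<one>, s} \<in> E" "s \<otimes> s \<noteq> \<one>"
      using that by (auto simp: N_def)
    then have "{inv s, inv s \<otimes> s} \<in> E"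
      by (subst edge) auto
    then have "{\<one>, inv s} \<in> E"
      using s by (simp add: insert_commute)
    moreover have "inv s \<otimes> inv s \<noteq> \<one>"
      using s by (metis inv_equality inv_closed inv_inv r_inv)
    ultimately show ?thesis
      using s by (simp add: N_def)
  qed
  obtain R where R: "R \<subseteq> N \<union> m_inv G ` N" "N \<subseteq> R \<union> m_inv G ` R" "\<And>s. s \<in> R \<Longrightarrow> inv s \<notin> R"
  proof -
    have "N \<subseteq> carrier G" "\<And>s. s \<in> N \<Longrightarrow> s \<otimes> s \<noteq> \<one>"
      by (auto simp: N_def)
    from exists_half_set[OF this] show thesis
      using that by blast
  qed
  have RN: "R \<subseteq> N"
    using R(1) N_inv by auto
  have RG: "R \<subseteq> carrier G" and SG: "S \<subseteq> carrier G"
    using RN by (auto simp: N_def S_def)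
  have "E = cayley_edges G S \<union> cayley_edges G R"
  proof (intro equalityI subsetI)
    fix e assume "e \<in> E"
    then obtain x y where e: "e = {x, y}" "x \<in> carrier G" "y \<in> carrier G"
      using E by blast
    define s where "s = inv x \<otimes> y"
    have s: "s \<in> carrier G" "y = x \<otimes> s"
      using e by (auto simp: s_def)
    then have "{\<one>, s} \<in> E"
      using edge e \<open>e \<in> E\<close> by blast
    then consider "s \<in> S" | "s \<in> R" | "inv s \<in> R"
      using s R(2) RG unfolding S_def N_def by (auto simp: subset_iff)
    then show "e \<in> cayley_edges G S \<union> cayley_edges G R"
    proof cases
      case 3
      have "e = {y, y \<otimes> inv s}"
        using e s by auto
      then show ?thesis
        using 3 e by (auto simp: cayley_edges_def)
    qed (use e s in \<open>auto simp: cayley_edges_def\<close>)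
  next
    fix e assume "e \<in> cayley_edges G S \<union> cayley_edges G R"
    then obtain x s where "x \<in> carrier G" "s \<in> S \<union> N" "e = {x, x \<otimes> s}"
      using RN by (auto simp: cayley_edges_def)
    then show "e \<in> E"
      using edge by (auto simp: S_def N_def)
  qed
  moreover have "cayley_edges G S \<inter> cayley_edges G R = {}"
  proof -
    have False if "x \<in> carrier G" "y \<in> carrier G" "s \<in> S" "t \<in> R" "{x, x \<otimes> s} = {y, y \<otimes> t}" for x y s t
    proof -
      have "t \<in> N"
        using that RN by auto
      have "t = s \<or> t = inv s"
        using cayley_edge_eq[of x s y t] that RG SG by auto
      moreover have "inv s = s"
        using that by (auto simp: S_def inv_equality)
      ultimately show False
        using \<open>t \<in> N\<close> \<open>s \<in> S\<close> by (auto simp: S_def N_def)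
    qed
    then show ?thesis
      unfolding cayley_edges_def by blast
  qed
  moreover obtain \<F> where "one_factorization (carrier G) (cayley_edges G S) \<F>"
      "translation_invariant G \<F>"
    using involutions_one_factorization[OF SG] unfolding S_def by blast
  moreover have "\<exists>\<F>. one_factorization (carrier G) (cayley_edges G R) \<F> \<and> translation_invariant G \<F>"
  proof (cases "N = {}")
    case True
    then have "R = {}"
      using RN by auto
    then show ?thesis
      by (auto simp: cayley_edges_def one_factorization_def translation_invariant_def partition_on_empty
          intro!: exI[of _ "{}"])
  next
    case False
    then have GN: "carrier G \<lesssim> N"
      using card by (auto simp: N_def)
    then have "infinite N"
      using assms(1) by (meson inj_on_finite lepoll_def)
    \<comment> \<open>Halving does not lower an infinite cardinality: \<open>N\<close> is covered by
      \<open>R\<close> and its inverses, so \<open>R\<close> is as large as \<open>N\<close> and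
      hence as the group.\<close>
    moreover have "|N| \<le>o |R \<union> m_inv G ` R|"
      using R(2) by (rule card_of_mono1)
    ultimately have "infinite R"
      using card_of_ordLeq_infinite by blast
    then have "|R \<union> m_inv G ` R| \<le>o |R|"
      by (intro card_of_Un_ordLeq_infinite) auto
    then have "|N| \<le>o |R|"
      using \<open>|N| \<le>o |R \<union> m_inv G ` R|\<close> ordLeq_transitive by blast
    then have "N \<lesssim> R"
      by (simp add: lepoll_def card_of_ordLeq[symmetric])
    then have "R \<approx> carrier G"
      using GN RG lepoll_trans lepoll_antisym subset_imp_lepoll by metis
    then show ?thesis
      using starter_one_factorization assms(1) RG R(3) by blast
  qed
  ultimately show ?thesis
    using one_factorization_Un translation_invariant_Un by metis
qed

end

section \<open>Regularity via group structures on the vertex set\<close>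

lemma map_edges_cong:
  "(\<And>e x. \<lbrakk>e \<in> F; x \<in> e\<rbrakk> \<Longrightarrow> f x = g x) \<Longrightarrow> map_edges f F = map_edges g F"
  unfolding map_edges_def by (intro image_cong) auto

lemma (in group) regular_translations:
  assumes "translation_invariant G \<F>" and sub: "\<And>F e. \<lbrakk>F \<in> \<F>; e \<in> F\<rbrakk> \<Longrightarrow> e \<subseteq> carrier G"
  shows "regular (carrier G) \<F>"
proof -
  \<comment> \<open>The elements of \<open>BijGroup\<close> are extensional functions, hence the
    restriction to the carrier.\<close>
  define \<phi> where "\<phi> g = restrict (mult G g) (carrier G)" for g
  have bij: "\<phi> g \<in> Bij (carrier G)" if "g \<in> carrier G" for g
  proof -
    have "bij_betw (mult G g) (carrier G) (carrier G)"
      by (rule bij_betw_byWitness[of _ "mult G (inv g)"]) (use that in auto)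
    then have "bij_betw (\<phi> g) (carrier G) (carrier G)"
      by (simp add: \<phi>_def cong: bij_betw_cong)
    then show ?thesis
      by (simp add: Bij_def \<phi>_def)
  qed
  have "\<phi> \<in> hom G (BijGroup (carrier G))"
  proof (rule homI)
    show "\<phi> g \<in> carrier (BijGroup (carrier G))" if "g \<in> carrier G" for g
      using bij[OF that] by (simp add: BijGroup_def)
    show "\<phi> (g \<otimes> h) = \<phi> g \<otimes>\<^bsub>BijGroup (carrier G)\<^esub> \<phi> h" if "g \<in> carrier G" "h \<in> carrier G" for g h
      using that bij by (auto simp: BijGroup_def \<phi>_def compose_def m_assoc)
  qed
  then interpret group_hom G "BijGroup (carrier G)" \<phi>
    by (simp add: group_hom_def group_hom_axioms_def group_BijGroup is_group)
  define A where "A = \<phi> ` carrier G"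
  have "subgroup A (BijGroup (carrier G))"
    unfolding A_def by (rule img_is_subgroup)
  moreover have "map_edges (\<phi> g) F \<in> \<F>" if "g \<in> carrier G" "F \<in> \<F>" for g F
  proof -
    have "map_edges (\<phi> g) F = map_edges (mult G g) F"
      using sub[OF that(2)] by (intro map_edges_cong) (auto simp: \<phi>_def)
    then show ?thesis
      using assms(1) that by (simp add: translation_invariant_def)
  qed
  moreover have "\<exists>!f. f \<in> A \<and> f x = y" if "x \<in> carrier G" "y \<in> carrier G" for x y
  proof (rule ex1I[of _ "\<phi> (y \<otimes> inv x)"])
    show "\<phi> (y \<otimes> inv x) \<in> A \<and> \<phi> (y \<otimes> inv x) x = y"
      using that by (auto simp: A_def \<phi>_def)
    show "f = \<phi> (y \<otimes> inv x)" if "f \<in> A \<and> f x = y" for f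
      using that \<open>x \<in> carrier G\<close> by (auto simp: A_def \<phi>_def)
  qed
  ultimately have "group_regular ((BijGroup (carrier G))\<lparr>carrier := A\<rparr>) (carrier G) \<F>"
    unfolding group_regular_def automorphism_group_def sharply_transitive_def
    by (intro exI[of _ A]) (auto simp: A_def)
  moreover have "group ((BijGroup (carrier G))\<lparr>carrier := A\<rparr>)"
    using \<open>subgroup A (BijGroup (carrier G))\<close> group_BijGroup by (rule subgroup.subgroup_is_group)
  ultimately show ?thesis
    unfolding regular_def by blast
qed

text \<open>Sharp transitivity makes evaluation at a base vertex \<open>v\<close> a bijection from
  the automorphism group \<open>A\<close> onto \<open>V\<close>. When composition is transported
  along it, left multiplication by \<open>f v\<close> agrees with \<open>f\<close> on
  \<open>V\<close>: if \<open>x = h v\<close>, the product of \<open>f v\<close> and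
  \<open>x\<close> is the value of the composite of \<open>f\<close> and \<open>h\<close> at
  \<open>v\<close>, which is \<open>f x\<close>.\<close>

lemma group_regular_imp_translations:
  assumes "group_regular H V \<H>" "V \<noteq> {}"
    and sub: "\<And>F e. \<lbrakk>F \<in> \<H>; e \<in> F\<rbrakk> \<Longrightarrow> e \<subseteq> V"
  shows "\<exists>G :: 'v monoid. group G \<and> carrier G = V \<and> translation_invariant G (\<H> :: 'v set set set)"
proof -
  obtain A where A: "subgroup A (BijGroup V)" "\<And>f F. \<lbrakk>f \<in> A; F \<in> \<H>\<rbrakk> \<Longrightarrow> map_edges f F \<in> \<H>"
    and sharp: "\<And>x y. \<lbrakk>x \<in> V; y \<in> V\<rbrakk> \<Longrightarrow> \<exists>!f. f \<in> A \<and> f x = y"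
    using assms(1) by (auto simp: group_regular_def automorphism_group_def sharply_transitive_def)
  obtain v where v: "v \<in> V"
    using \<open>V \<noteq> {}\<close> by blast
  define B where "B = (BijGroup V)\<lparr>carrier := A\<rparr>"
  define ev where "ev f = f v" for f :: "'v \<Rightarrow> 'v"
  have "group B"
    unfolding B_def using A(1) group_BijGroup by (rule subgroup.subgroup_is_group)
  have AV: "f \<in> Bij V" if "f \<in> A" for f
    using subgroup.mem_carrier[OF A(1) that] by (simp add: BijGroup_def)
  have AV': "f x \<in> V" if "f \<in> A" "x \<in> V" for f x
    using Bij_imp_funcset[OF AV[OF that(1)]] that(2) by auto
  have inj: "inj_on ev A"
    using sharp[OF v] AV' v by (auto simp: inj_on_def ev_def)
  have img: "ev ` A = V"
    using sharp[OF v] AV' v by (auto simp: ev_def image_iff) metis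
  have "group (image_group ev B)"
    using group.inj_imp_image_group_is_group[OF \<open>group B\<close>, of ev] inj by (simp add: B_def)
  moreover have "carrier (image_group ev B) = V"
    by (simp add: image_group_carrier B_def img)
  moreover have "translation_invariant (image_group ev B) \<H>"
    unfolding translation_invariant_def
  proof (intro ballI)
    fix g F assume "g \<in> carrier (image_group ev B)" "F \<in> \<H>"
    then have "g \<in> ev ` A"
      by (simp add: image_group_carrier B_def)
    then obtain f where f: "f \<in> A" "g = ev f"
      by blast
    have "mult (image_group ev B) g x = f x" if "x \<in> V" for x
    proof -
      have "x \<in> ev ` A"
        using that img by simp
      then obtain h where h: "h \<in> A" "x = ev h"
        by blast
      then have "mult (image_group ev B) g x = ev (f \<otimes>\<^bsub>BijGroup V\<^esub> h)"
        using f inj by (simp add: image_group_def B_def)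
      also have "\<dots> = f x"
        using f h AV v by (simp add: BijGroup_def compose_def ev_def)
      finally show ?thesis .
    qed
    then have "map_edges (mult (image_group ev B) g) F = map_edges f F"
      using sub[OF \<open>F \<in> \<H>\<close>] by (intro map_edges_cong) auto
    then show "map_edges (mult (image_group ev B) g) F \<in> \<H>"
      using A(2) f \<open>F \<in> \<H>\<close> by simp
  qed
  ultimately show ?thesis
    by blast
qed

lemma group_of_eqpoll:
  assumes "group G" "carrier G \<approx> A"
  obtains G' :: "'a monoid" and f where "group G'" "carrier G' = (A :: 'a set)" "f \<in> iso G G'"
proof -
  obtain f where f: "bij_betw f (carrier G) A"
    using assms(2) by (auto simp: eqpoll_def)
  then have "inj_on f (carrier G)" "f ` carrier G = A"
    by (auto simp: bij_betw_def)
  then show thesis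
    using that[of "image_group f G" f] group.inj_imp_image_group_is_group[OF assms(1), of f]
      inj_imp_image_group_iso[of f G] by (simp add: image_group_carrier)
qed

section \<open>Groups of prescribed cardinality\<close>

text \<open>The finite subsets of \<open>A\<close> form a group of exponent 2 under symmetric
  difference. An infinite set has as many finite subsets as elements, so this structure can be
  carried over to \<open>A\<close> itself.\<close>

lemma exponent_2_group_exists:
  assumes "infinite (A :: 'a set)"
  shows "\<exists>G :: 'a monoid. group G \<and> carrier G = A \<and> (\<forall>x\<in>A. x \<otimes>\<^bsub>G\<^esub> x = \<one>\<^bsub>G\<^esub>)"
proof -
  define P :: "'a set monoid" where "P = \<lparr>carrier = Fpow A, mult = (\<lambda>X Y. (X - Y) \<union> (Y - X)), one = {}\<rparr>"
  have "group P"
  proof (rule groupI)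
    show "\<exists>Y\<in>carrier P. Y \<otimes>\<^bsub>P\<^esub> X = \<one>\<^bsub>P\<^esub>" if "X \<in> carrier P" for X
      using that by (intro bexI[of _ X]) (auto simp: P_def)
  qed (auto simp: P_def Fpow_def)
  moreover have "carrier P \<approx> A"
    using eqpoll_Fpow[OF assms] by (simp add: P_def)
  ultimately obtain G :: "'a monoid" and f where G: "group G" "carrier G = A" "f \<in> iso P G"
    by (rule group_of_eqpoll)
  interpret group_hom P G f
    using \<open>group P\<close> G by (simp add: group_hom_def group_hom_axioms_def iso_def)
  have "x \<otimes>\<^bsub>G\<^esub> x = \<one>\<^bsub>G\<^esub>" if xA: "x \<in> A" for x
  proof -
    obtain X where X: "X \<in> carrier P" "x = f X"
      using G xA by (auto simp: iso_def bij_betw_def)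
    then have "x \<otimes>\<^bsub>G\<^esub> x = f (X \<otimes>\<^bsub>P\<^esub> X)"
      by simp
    also have "X \<otimes>\<^bsub>P\<^esub> X = \<one>\<^bsub>P\<^esub>"
      by (simp add: P_def)
    finally show ?thesis
      by simp
  qed
  then show ?thesis
    using G by blast
qed

lemma group_exists:
  assumes "(A :: 'a set) \<noteq> {}"
  shows "\<exists>G :: 'a monoid. group G \<and> carrier G = A"
proof (cases "finite A")
  case True
  then have "carrier (integer_mod_group (card A)) \<approx> A"
    using assms by (simp add: carrier_integer_mod_group eqpoll_iff_card)
  then show ?thesis
    using group_of_eqpoll[OF group_integer_mod_group] by metis
next
  case False
  then show ?thesis
    using exponent_2_group_exists by blast
qed

text \<open>For infinite \<open>X\<close> the cofactor is not determined by the cardinalities; the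
  largest choice, \<open>X\<close> itself, is fixed so that a group on it can be as large as the
  whole vertex set.\<close>

lemma cardinal_dvd_cofactor:
  assumes "cardinal_dvd X' X" "X' \<noteq> {}" "X \<noteq> {}"
  shows "\<exists>A. A \<noteq> {} \<and> X' \<times> A \<approx> X \<and> (infinite X \<longrightarrow> A = X)"
proof (cases "finite X")
  case True
  then have fin: "finite X'" "card X' dvd card X"
    using assms(1) by (auto simp: cardinal_dvd_def)
  then obtain k where k: "card X = card X' * k"
    by auto
  have "card X' > 0" "card X > 0"
    using fin assms True by (auto simp: card_gt_0_iff)
  then have "k \<le> card X" "k > 0"
    using k by auto
  then obtain A where A: "A \<subseteq> X" "card A = k"
    using obtain_subset_with_card_n by metis
  then have "finite A"
    using True finite_subset by blast
  then have "X' \<times> A \<approx> X"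
    using True fin k A by (simp add: eqpoll_iff_card card_cartesian_product)
  then show ?thesis
    using A \<open>k > 0\<close> True by (intro exI[of _ A]) auto
next
  case False
  then have "|X'| \<le>o |X|"
    using assms(1) by (auto simp: cardinal_dvd_def lepoll_def card_of_ordLeq[symmetric])
  then have "X' \<times> X \<approx> X"
    using card_of_Times_infinite_simps(3)[OF False assms(2)] by (simp add: eqpoll_iff_card_of_ordIso)
  then show ?thesis
    using assms(3) by (intro exI[of _ X]) simp
qed

section \<open>Extension of a regular \<open>1\<close>-factorization\<close>

lemma map_edges_map_edges: "map_edges f (map_edges g F) = map_edges (\<lambda>x. f (g x)) F"
  by (simp add: map_edges_def image_image)

lemma doubleton_in_equipartite_edges_iff:
  "{u, v} \<in> equipartite_edges I J \<longleftrightarrow> u \<in> I \<times> J \<and> v \<in> I \<times> J \<and> fst u \<noteq> fst v"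
  by (cases u; cases v) (auto simp: equipartite_edges_def doubleton_eq_iff)

lemma equipartite_edgeE:
  assumes "e \<in> equipartite_edges I J"
  obtains u v where "e = {u, v}" "u \<in> I \<times> J" "v \<in> I \<times> J" "fst u \<noteq> fst v"
  using assms by (force simp: equipartite_edges_def)

lemma one_factorization_image:
  assumes f: "bij_betw f V V'" and fac: "one_factorization V E \<F>"
    and sub: "\<And>e. e \<in> E \<Longrightarrow> e \<subseteq> V"
  shows "one_factorization V' (map_edges f E) (image (map_edges f) \<F>)"
proof (rule one_factorizationI)
  note D = one_factorizationD[OF fac]
  have inj: "inj_on f V" and V': "V' = f ` V"
    using f by (auto simp: bij_betw_def)
  have sub': "e \<subseteq> V" if "F \<in> \<F>" "e \<in> F" for F e
    using D(1) sub that by blast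
  show "\<Union>(map_edges f ` \<F>) = map_edges f E"
    unfolding D(1)[symmetric] by (auto simp: map_edges_def)
  show "{} \<notin> map_edges f ` \<F>"
    using D(2) by (auto simp: map_edges_def)
  show "F = F'" if F: "F \<in> map_edges f ` \<F>" "F' \<in> map_edges f ` \<F>" "e \<in> F" "e \<in> F'" for F F' e
  proof -
    obtain F1 F2 e1 e2 where *: "F1 \<in> \<F>" "F2 \<in> \<F>" "F = map_edges f F1" "F' = map_edges f F2"
        "e1 \<in> F1" "e2 \<in> F2" "f ` e1 = f ` e2"
      using F by (auto simp: map_edges_def)
    then have "e1 = e2"
      using inj sub' by (simp add: inj_on_image_eq_iff)
    then show ?thesis
      using * D(3) by blast
  qed
  show "\<exists>!e. e \<in> F \<and> v \<in> e" if F: "F \<in> map_edges f ` \<F>" "v \<in> V'" for F v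
  proof -
    obtain F1 w where *: "F1 \<in> \<F>" "F = map_edges f F1" "w \<in> V" "v = f w"
      using F V' by auto
    then obtain e where e: "e \<in> F1" "w \<in> e" "\<And>d. d \<in> F1 \<Longrightarrow> w \<in> d \<Longrightarrow> d = e"
      using D(4)[of F1 w] by metis
    show ?thesis
    proof (rule ex1I[of _ "f ` e"])
      show "f ` e \<in> F \<and> v \<in> f ` e"
        using * e(1,2) by (auto simp: map_edges_def)
      show "d = f ` e" if d: "d \<in> F \<and> v \<in> d" for d
      proof -
        obtain d' where d': "d' \<in> F1" "d = f ` d'"
          using d * by (auto simp: map_edges_def)
        then have "w \<in> d'"
          using d * inj_on_image_mem_iff[OF inj, of w d'] sub' by auto
        then show ?thesis
          using d' e(3) by blast
      qed
    qed
  qed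
qed

lemma translation_invariant_image:
  assumes inj: "inj_on f (carrier G)" and "group G" and inv: "translation_invariant G \<F>"
    and sub: "\<And>F e. \<lbrakk>F \<in> \<F>; e \<in> F\<rbrakk> \<Longrightarrow> e \<subseteq> carrier G"
  shows "translation_invariant (image_group f G) (image (map_edges f) \<F>)"
  unfolding translation_invariant_def
proof (intro ballI)
  interpret group G by fact
  fix g' F' assume "g' \<in> carrier (image_group f G)" "F' \<in> map_edges f ` \<F>"
  then obtain g F where *: "g \<in> carrier G" "g' = f g" "F \<in> \<F>" "F' = map_edges f F"
    by (auto simp: image_group_carrier)
  have "map_edges (mult (image_group f G) g') F' = map_edges f (map_edges (mult G g) F)"
    unfolding * map_edges_map_edges
  proof (rule map_edges_cong)
    fix e x assume "e \<in> F" "x \<in> e"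
    then have "x \<in> carrier G"
      using sub *(3) by blast
    then show "mult (image_group f G) (f g) (f x) = f (g \<otimes>\<^bsub>G\<^esub> x)"
      using * inj by (simp add: image_group_def)
  qed
  then show "map_edges (mult (image_group f G) g') F' \<in> map_edges f ` \<F>"
    using * inv by (simp add: translation_invariant_def)
qed

lemma invariant_edges_Union: "translation_invariant G \<F> \<Longrightarrow> invariant_edges G (\<Union>\<F>)"
  unfolding translation_invariant_def invariant_edges_def map_edges_def by blast

text \<open>Translation by \<open>inv g\<close> undoes translation by \<open>g\<close>, so an edge
  outside \<open>E'\<close> cannot be moved into it.\<close>

lemma (in group) invariant_edges_Diff:
  assumes "invariant_edges G E" "invariant_edges G E'" "\<And>e. e \<in> E \<Longrightarrow> e \<subseteq> carrier G"
  shows "invariant_edges G (E - E')"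
  unfolding invariant_edges_def
proof (intro ballI DiffI notI; elim DiffE)
  fix g e assume "g \<in> carrier G" "e \<in> E" "e \<notin> E'"
  then show "mult G g ` e \<in> E"
    using assms(1) by (simp add: invariant_edges_def)
  assume "mult G g ` e \<in> E'"
  then have "mult G (inv g) ` mult G g ` e \<in> E'"
    using assms(2) \<open>g \<in> carrier G\<close> unfolding invariant_edges_def by blast
  moreover have "mult G (inv g) ` mult G g ` e = e"
    using assms(3)[OF \<open>e \<in> E\<close>] \<open>g \<in> carrier G\<close> by (force simp: image_image)
  ultimately show False
    using \<open>e \<notin> E'\<close> by simp
qed

section \<open>Copies of a factorization in all cosets\<close>

definition copies :: "'t set \<Rightarrow> 'v set set \<Rightarrow> ('v \<times> 't) set set" where
  "copies T F = (\<lambda>(e, t). e \<times> {t}) ` (F \<times> T)"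

text \<open>All layers \<open>V \<times> {t}\<close> receive the same factor and are collected into
  one edge set. A vertex lies in exactly one layer, so it is covered exactly once, and an edge of a
  copy determines the edge it comes from.\<close>

lemma one_factorization_copies:
  assumes fac: "one_factorization V E \<F>" and "T \<noteq> {}"
  shows "one_factorization (V \<times> T) (copies T E) (copies T ` \<F>)"
proof (rule one_factorizationI)
  note D = one_factorizationD[OF fac]
  show "\<Union>(copies T ` \<F>) = copies T E"
    unfolding D(1)[symmetric] by (auto simp: copies_def)
  show "{} \<notin> copies T ` \<F>"
    using D(2) \<open>T \<noteq> {}\<close> by (auto simp: copies_def)
  show "F = F'" if F: "F \<in> copies T ` \<F>" "F' \<in> copies T ` \<F>" "e \<in> F" "e \<in> F'" for F F' e
  proof -
    obtain F1 F2 where *: "F1 \<in> \<F>" "F2 \<in> \<F>" "F = copies T F1" "F' = copies T F2"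
      using F by auto
    obtain e1 s where "e1 \<in> F1" "e = e1 \<times> {s}"
      using F(3) * by (auto simp: copies_def)
    moreover obtain e2 t where "e2 \<in> F2" "e = e2 \<times> {t}"
      using F(4) * by (auto simp: copies_def)
    ultimately have "e1 \<in> F2"
      by (auto simp: times_eq_iff)
    then show ?thesis
      using * \<open>e1 \<in> F1\<close> D(3) by blast
  qed
  show "\<exists>!e. e \<in> F \<and> v \<in> e" if F: "F \<in> copies T ` \<F>" "v \<in> V \<times> T" for F v
  proof -
    obtain F1 w t where *: "F1 \<in> \<F>" "F = copies T F1" "w \<in> V" "t \<in> T" "v = (w, t)"
      using F by auto
    then obtain e where e: "e \<in> F1" "w \<in> e" "\<And>d. d \<in> F1 \<Longrightarrow> w \<in> d \<Longrightarrow> d = e"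
      using D(4)[of F1 w] by metis
    show ?thesis
    proof (rule ex1I[of _ "e \<times> {t}"])
      show "e \<times> {t} \<in> F \<and> v \<in> e \<times> {t}"
        using * e(1,2) by (auto simp: copies_def)
      fix d assume "d \<in> F \<and> v \<in> d"
      then obtain d' where "d' \<in> F1" "w \<in> d'" "d = d' \<times> {t}"
        using * by (auto simp: copies_def)
      then show "d = e \<times> {t}"
        using e(3) by blast
    qed
  qed
qed

text \<open>Translation by \<open>(h, s)\<close> sends layer \<open>t\<close> to layer
  \<open>s \<otimes> t\<close>. It permutes the layers, which all carry the same factor, so only the
  action of \<open>h\<close> on that factor remains visible.\<close>

lemma translation_invariant_copies:
  assumes inv: "translation_invariant G \<F>" and "group T"
  shows "translation_invariant (G \<times>\<times> T) (copies (carrier T) ` \<F>)"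
  unfolding translation_invariant_def
proof (intro ballI)
  interpret T: group T by fact
  fix g F' assume "g \<in> carrier (G \<times>\<times> T)" "F' \<in> copies (carrier T) ` \<F>"
  then obtain h s F where *: "h \<in> carrier G" "s \<in> carrier T" "g = (h, s)" "F \<in> \<F>" "F' = copies (carrier T) F"
    by auto
  have edge: "mult (G \<times>\<times> T) g ` (e \<times> {t}) = (mult G h ` e) \<times> {s \<otimes>\<^bsub>T\<^esub> t}" for e t
    using * by (force simp: DirProd_def)
  have "map_edges (mult (G \<times>\<times> T) g) F' = copies (carrier T) (map_edges (mult G h) F)"
  proof (intro equalityI subsetI)
    fix d assume "d \<in> map_edges (mult (G \<times>\<times> T) g) F'"
    then obtain e t where "e \<in> F" "t \<in> carrier T" "d = mult (G \<times>\<times> T) g ` (e \<times> {t})"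
      using * by (auto simp: map_edges_def copies_def)
    then show "d \<in> copies (carrier T) (map_edges (mult G h) F)"
      using * unfolding edge by (force simp: map_edges_def copies_def)
  next
    fix d assume "d \<in> copies (carrier T) (map_edges (mult G h) F)"
    then obtain e t where et: "e \<in> F" "t \<in> carrier T" "d = (mult G h ` e) \<times> {t}"
      by (auto simp: map_edges_def copies_def)
    define t' where "t' = inv\<^bsub>T\<^esub> s \<otimes>\<^bsub>T\<^esub> t"
    have "t' \<in> carrier T" "s \<otimes>\<^bsub>T\<^esub> t' = t"
      using et * by (auto simp: t'_def)
    then have "d = mult (G \<times>\<times> T) g ` (e \<times> {t'})" "e \<times> {t'} \<in> F'"
      using et * unfolding edge by (auto simp: copies_def)
    then show "d \<in> map_edges (mult (G \<times>\<times> T) g) F'"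
      by (auto simp: map_edges_def)
  qed
  then show "map_edges (mult (G \<times>\<times> T) g) F' \<in> copies (carrier T) ` \<F>"
    using * inv by (auto simp: translation_invariant_def)
qed

section \<open>The extension inside a direct product\<close>

lemma equipartite_extension:
  fixes G :: "('a \<times> 'b) monoid" and K :: "('k, 'm) monoid_scheme" and L :: "('l, 'n) monoid_scheme"
  assumes "group G" "group K" "group L" and cG: "carrier G = I' \<times> J'"
    and fac: "one_factorization (I' \<times> J') (equipartite_edges I' J') \<H>"
    and inv: "translation_invariant G \<H>"
    and p: "bij_betw p (I' \<times> carrier K) I" and q: "bij_betw q (J' \<times> carrier L) J"
    and "infinite (I \<times> J)"
    and big: "I \<times> J \<lesssim> carrier K \<and> (\<forall>k\<in>carrier K. k \<otimes>\<^bsub>K\<^esub> k = \<one>\<^bsub>K\<^esub>) \<or>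
              I \<times> J \<lesssim> carrier L \<and> (\<forall>l\<in>carrier L. l \<otimes>\<^bsub>L\<^esub> l = \<one>\<^bsub>L\<^esub>)"
  shows "\<exists>\<G>. one_factorization (equipartite_verts I J) (equipartite_edges I J) \<G>
           \<and> regular (equipartite_verts I J) \<G>
           \<and> contains_subfactorization (equipartite_verts I J) (equipartite_edges I J) \<G>
               (equipartite_verts I' J') (equipartite_edges I' J') \<H>"
proof -
  interpret G: group G by fact
  interpret K: group K by fact
  interpret L: group L by fact
  define T where "T = K \<times>\<times> L"
  define P where "P = G \<times>\<times> T"
  interpret T: group T
    unfolding T_def by (intro DirProd_group) fact+
  interpret P: group P
    unfolding P_def by (intro DirProd_group) (fact | simp add: T.is_group)+
  have cP: "carrier P = (I' \<times> J') \<times> (carrier K \<times> carrier L)"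
    by (simp add: P_def T_def cG)
  \<comment> \<open>The parts of the large graph are indexed by \<open>I\<close>, that is, through
    \<open>p\<close>, by \<open>I' \<times> carrier K\<close>: the vertex
    \<open>((i, j), (k, l))\<close> lies in part \<open>(i, k)\<close>.\<close>
  define part where "part v = (fst (fst v), fst (snd v))" for v :: "('a \<times> 'b) \<times> ('k \<times> 'l)"
  define E where "E = {{x, y} | x y. x \<in> carrier P \<and> y \<in> carrier P \<and> part x \<noteq> part y}"
  have E_iff: "{x, y} \<in> E \<longleftrightarrow> x \<in> carrier P \<and> y \<in> carrier P \<and> part x \<noteq> part y" for x y
  proof
    assume "{x, y} \<in> E"
    then obtain a b where "{x, y} = {a, b}" "a \<in> carrier P" "b \<in> carrier P" "part a \<noteq> part b"
      unfolding E_def by blast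
    then show "x \<in> carrier P \<and> y \<in> carrier P \<and> part x \<noteq> part y"
      unfolding doubleton_eq_iff by fastforce
  qed (unfold E_def, blast)
  have EE: "\<exists>x y. e = {x, y} \<and> x \<noteq> y \<and> x \<in> carrier P \<and> y \<in> carrier P" if "e \<in> E" for e
  proof -
    obtain x y where "e = {x, y}" "x \<in> carrier P" "y \<in> carrier P" "part x \<noteq> part y"
      using \<open>e \<in> E\<close> unfolding E_def by blast
    then show ?thesis
      by blast
  qed
  note D = one_factorizationD[OF fac]
  \<comment> \<open>If the components in \<open>K\<close> agree, lying in different parts means
    adjacency of the components in \<open>G\<close>; this is preserved because the small edge set is
    the union of the invariant family \<open>\<H>\<close>. If they differ, cancellation in
    \<open>K\<close> keeps them different.\<close>
  have part_mult: "part (g \<otimes>\<^bsub>P\<^esub> x) \<noteq> part (g \<otimes>\<^bsub>P\<^esub> y)"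
    if gxy: "g \<in> carrier P" "x \<in> carrier P" "y \<in> carrier P" "part x \<noteq> part y" for g x y
  proof -
    obtain u k l where x: "x = (u, (k, l))" "u \<in> I' \<times> J'" "k \<in> carrier K"
      using gxy(2) cP by auto
    obtain u' k' l' where y: "y = (u', (k', l'))" "u' \<in> I' \<times> J'" "k' \<in> carrier K"
      using gxy(3) cP by auto
    obtain a b c where g: "g = (a, (b, c))" "a \<in> carrier G" "b \<in> carrier K"
      using gxy(1) cP cG by auto
    show ?thesis
    proof (cases "k = k'")
      case True
      then have "{u, u'} \<in> equipartite_edges I' J'"
        using gxy(4) x y by (auto simp: doubleton_in_equipartite_edges_iff part_def)
      then have "mult G a ` {u, u'} \<in> equipartite_edges I' J'"
        using invariant_edges_Union[OF inv] g(2) unfolding D(1) invariant_edges_def by blast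
      then have "fst (a \<otimes>\<^bsub>G\<^esub> u) \<noteq> fst (a \<otimes>\<^bsub>G\<^esub> u')"
        by (simp add: doubleton_in_equipartite_edges_iff)
      then show ?thesis
        by (simp add: part_def P_def T_def x y g)
    next
      case False
      then show ?thesis
        using x y g by (simp add: part_def P_def T_def)
    qed
  qed
  have invE: "invariant_edges P E"
    unfolding invariant_edges_def
  proof (intro ballI)
    fix g e assume g: "g \<in> carrier P" and "e \<in> E"
    then obtain x y where "e = {x, y}" "x \<in> carrier P" "y \<in> carrier P" "part x \<noteq> part y"
      unfolding E_def by blast
    then show "mult P g ` e \<in> E"
      using g part_mult by (simp add: E_iff)
  qed
  define E1 where "E1 = copies (carrier T) (equipartite_edges I' J')"
  have E1_sub: "E1 \<subseteq> E"
  proof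
    fix e assume "e \<in> E1"
    then obtain d t where dt: "d \<in> equipartite_edges I' J'" "t \<in> carrier T" "e = d \<times> {t}"
      by (auto simp: E1_def copies_def)
    obtain u v where uv: "d = {u, v}" "u \<in> I' \<times> J'" "v \<in> I' \<times> J'" "fst u \<noteq> fst v"
      using dt(1) by (rule equipartite_edgeE)
    then have "e = {(u, t), (v, t)}"
      using dt by auto
    then show "e \<in> E"
      using uv dt by (auto simp: E_iff P_def cG part_def)
  qed
  define \<F>\<^sub>1 where "\<F>\<^sub>1 = copies (carrier T) ` \<H>"
  have fac1: "one_factorization (carrier P) E1 \<F>\<^sub>1"
    using one_factorization_copies[OF fac T.carrier_not_empty]
    by (simp add: P_def cG E1_def \<F>\<^sub>1_def)
  have inv1: "translation_invariant P \<F>\<^sub>1"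
    unfolding P_def \<F>\<^sub>1_def using inv T.is_group by (rule translation_invariant_copies)
  have "invariant_edges P E1"
    using invariant_edges_Union[OF inv1] one_factorizationD(1)[OF fac1] by simp
  then have inv2: "invariant_edges P (E - E1)"
    using invE by (intro P.invariant_edges_Diff) (auto simp: E_def)

  \<comment> \<open>The first coordinate of \<open>\<psi> v\<close> encodes exactly the part of
    \<open>v\<close>, so \<open>\<psi>\<close> carries \<open>E\<close> to the edges of the
    equipartite graph on \<open>I\<close> and \<open>J\<close>.\<close>
  define \<psi> where "\<psi> v = (p (part v), q (snd (fst v), snd (snd v)))" for v
  have \<psi>: "bij_betw \<psi> (carrier P) (I \<times> J)"
    unfolding bij_betw_def
  proof
    have inj: "inj_on p (I' \<times> carrier K)" "inj_on q (J' \<times> carrier L)"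
      using p q by (auto simp: bij_betw_def)
    show "inj_on \<psi> (carrier P)"
    proof (rule inj_onI)
      fix x y assume "x \<in> carrier P" "y \<in> carrier P" "\<psi> x = \<psi> y"
      then show "x = y"
        using inj_onD[OF inj(1), of "part x" "part y"]
          inj_onD[OF inj(2), of "(snd (fst x), snd (snd x))" "(snd (fst y), snd (snd y))"]
        by (auto simp: \<psi>_def part_def cP)
    qed
    show "\<psi> ` carrier P = I \<times> J"
    proof (intro equalityI subsetI)
      fix w assume "w \<in> \<psi> ` carrier P"
      then show "w \<in> I \<times> J"
        using bij_betwE[OF p] bij_betwE[OF q] by (auto simp: \<psi>_def part_def cP)
    next
      fix w assume "w \<in> I \<times> J"
      then have "fst w \<in> p ` (I' \<times> carrier K)" "snd w \<in> q ` (J' \<times> carrier L)"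
        using p q by (auto simp: bij_betw_def)
      then obtain i k j l where "i \<in> I'" "k \<in> carrier K" "j \<in> J'" "l \<in> carrier L"
          "w = \<psi> ((i, j), (k, l))"
        by (cases w) (auto simp: \<psi>_def part_def)
      then show "w \<in> \<psi> ` carrier P"
        by (auto simp: cP)
    qed
  qed
  have "carrier P \<approx> I \<times> J"
    using \<psi> by (auto simp: eqpoll_def)
  then have infP: "infinite (carrier P)"
    using \<open>infinite (I \<times> J)\<close> by (simp add: eqpoll_finite_iff)

  define N where "N = {s \<in> carrier P. {\<one>\<^bsub>P\<^esub>, s} \<in> E - E1 \<and> s \<otimes>\<^bsub>P\<^esub> s \<noteq> \<one>\<^bsub>P\<^esub>}"
  have notE1: "{x, y} \<notin> E1" if "snd x \<noteq> snd y" for x y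
  proof
    assume "{x, y} \<in> E1"
    then obtain e t where "{x, y} = e \<times> {t}"
      by (auto simp: E1_def copies_def)
    then have "x \<in> e \<times> {t}" "y \<in> e \<times> {t}"
      by blast+
    then show False
      using that by auto
  qed
  have "N = {} \<or> carrier P \<lesssim> N"
  proof (cases "N = {}")
    case False
    then obtain u k l where s: "(u, (k, l)) \<in> N"
      by (metis all_not_in_conv prod.exhaust)
    then have s': "(u, (k, l)) \<in> carrier P" "part \<one>\<^bsub>P\<^esub> \<noteq> part (u, (k, l))"
        "(u, (k, l)) \<otimes>\<^bsub>P\<^esub> (u, (k, l)) \<noteq> \<one>\<^bsub>P\<^esub>"
      by (simp_all add: N_def E_iff)
    then have *: "u \<in> carrier G" "k \<in> carrier K" "l \<in> carrier L"
        "\<not> (u \<otimes>\<^bsub>G\<^esub> u = \<one>\<^bsub>G\<^esub> \<and> k \<otimes>\<^bsub>K\<^esub> k = \<one>\<^bsub>K\<^esub> \<and> l \<otimes>\<^bsub>L\<^esub> l = \<one>\<^bsub>L\<^esub>)"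
      by (simp_all add: P_def T_def)
    have remove: "A \<lesssim> A - {a}" if "infinite A" for A :: "'z set" and a
      using subset_imp_lepoll[of A "insert a (A - {a})"] infinite_insert_eqpoll[of "A - {a}" a] that
      by (simp add: insert_Diff_if subset_insertI lepoll_trans2)
    \<comment> \<open>Moving the component of \<open>s\<close> in the large exponent-2 factor away from the identity keeps \<open>s\<close> in \<open>N\<close>,
      since that component never decides whether \<open>s\<close> is an involution.\<close>
    from big have "\<exists>S\<subseteq>N. I \<times> J \<lesssim> S"
    proof
      assume K: "I \<times> J \<lesssim> carrier K \<and> (\<forall>k\<in>carrier K. k \<otimes>\<^bsub>K\<^esub> k = \<one>\<^bsub>K\<^esub>)"
      then have "infinite (carrier K)"
        using \<open>infinite (I \<times> J)\<close> by (meson inj_on_finite lepoll_def)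
      then have "I \<times> J \<lesssim> carrier K - {\<one>\<^bsub>K\<^esub>}"
        by (rule lepoll_trans[OF conjunct1[OF K] remove])
      then have "I \<times> J \<lesssim> (\<lambda>k'. (u, (k', l))) ` (carrier K - {\<one>\<^bsub>K\<^esub>})"
        by (simp add: inj_on_def)
      moreover have "(\<lambda>k'. (u, (k', l))) ` (carrier K - {\<one>\<^bsub>K\<^esub>}) \<subseteq> N"
      proof (intro image_subsetI)
        fix k' assume k': "k' \<in> carrier K - {\<one>\<^bsub>K\<^esub>}"
        \<comment> \<open>Here \<open>k' \<noteq> \<one>\<close> alone both separates the parts and
          leaves the layer of the identity.\<close>
        have "part \<one>\<^bsub>P\<^esub> \<noteq> part (u, (k', l))"
          using k' by (auto simp: part_def P_def T_def)
        moreover have "{\<one>\<^bsub>P\<^esub>, (u, (k', l))} \<notin> E1"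
          using k' by (intro notE1) (auto simp: P_def T_def)
        moreover have "(u, (k', l)) \<in> carrier P" "(u, (k', l)) \<otimes>\<^bsub>P\<^esub> (u, (k', l)) \<noteq> \<one>\<^bsub>P\<^esub>"
          using k' * K by (auto simp: P_def T_def)
        ultimately show "(u, (k', l)) \<in> N"
          by (simp add: N_def E_iff)
      qed
      ultimately show ?thesis
        by blast
    next
      assume L: "I \<times> J \<lesssim> carrier L \<and> (\<forall>l\<in>carrier L. l \<otimes>\<^bsub>L\<^esub> l = \<one>\<^bsub>L\<^esub>)"
      then have "infinite (carrier L)"
        using \<open>infinite (I \<times> J)\<close> by (meson inj_on_finite lepoll_def)
      then have "I \<times> J \<lesssim> carrier L - {\<one>\<^bsub>L\<^esub>}"
        by (rule lepoll_trans[OF conjunct1[OF L] remove])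
      then have "I \<times> J \<lesssim> (\<lambda>l'. (u, (k, l'))) ` (carrier L - {\<one>\<^bsub>L\<^esub>})"
        by (simp add: inj_on_def)
      moreover have "(\<lambda>l'. (u, (k, l'))) ` (carrier L - {\<one>\<^bsub>L\<^esub>}) \<subseteq> N"
      proof (intro image_subsetI)
        fix l' assume l': "l' \<in> carrier L - {\<one>\<^bsub>L\<^esub>}"
        \<comment> \<open>Parts ignore the component in \<open>L\<close>, so this is inherited from
          the given element of \<open>N\<close>; \<open>l' \<noteq> \<one>\<close> only serves to
          leave the layer of the identity.\<close>
        have "part \<one>\<^bsub>P\<^esub> \<noteq> part (u, (k, l'))"
          using s' by (simp add: part_def)
        moreover have "{\<one>\<^bsub>P\<^esub>, (u, (k, l'))} \<notin> E1"
          using l' by (intro notE1) (auto simp: P_def T_def)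
        moreover have "(u, (k, l')) \<in> carrier P" "(u, (k, l')) \<otimes>\<^bsub>P\<^esub> (u, (k, l')) \<noteq> \<one>\<^bsub>P\<^esub>"
          using l' * L by (auto simp: P_def T_def)
        ultimately show "(u, (k, l')) \<in> N"
          by (simp add: N_def E_iff)
      qed
      ultimately show ?thesis
        by blast
    qed
    then have "carrier P \<lesssim> N"
      using \<open>carrier P \<approx> I \<times> J\<close> subset_imp_lepoll lepoll_trans1 lepoll_trans by metis
    then show ?thesis ..
  qed simp
  then obtain \<F>\<^sub>2 where fac2: "one_factorization (carrier P) (E - E1) \<F>\<^sub>2" and inv2: "translation_invariant P \<F>\<^sub>2"
    using P.invariant_one_factorization[OF infP inv2] EE unfolding N_def by blast
  define \<F> where "\<F> = \<F>\<^sub>1 \<union> \<F>\<^sub>2"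
  have "E1 \<union> (E - E1) = E"
    using E1_sub by blast
  then have facP: "one_factorization (carrier P) E \<F>"
    using one_factorization_Un[OF fac1 fac2] by (simp add: \<F>_def Diff_disjoint)
  have invP: "translation_invariant P \<F>"
    unfolding \<F>_def using inv1 inv2 by (rule translation_invariant_Un)
  have sub: "e \<subseteq> carrier P" if "e \<in> E" for e
    using EE[OF that] by auto

  have \<psi>_surj: "\<psi> ` carrier P = I \<times> J"
    using \<psi> by (rule bij_betw_imp_surj_on)
  have \<psi>_E: "map_edges \<psi> E = equipartite_edges I J"
  proof (intro equalityI subsetI)
    fix e assume "e \<in> map_edges \<psi> E"
    then obtain x y where xy: "e = {\<psi> x, \<psi> y}" "x \<in> carrier P" "y \<in> carrier P" "part x \<noteq> part y"
      unfolding map_edges_def E_def by blast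
    then have "p (part x) \<noteq> p (part y)"
      using inj_onD[OF bij_betw_imp_inj_on[OF p], of "part x" "part y"] by (auto simp: part_def cP)
    then show "e \<in> equipartite_edges I J"
      using imageI[OF xy(2), of \<psi>] imageI[OF xy(3), of \<psi>]
      unfolding xy(1) doubleton_in_equipartite_edges_iff \<psi>_surj by (simp add: \<psi>_def)
  next
    fix e assume "e \<in> equipartite_edges I J"
    then obtain u v where uv: "e = {u, v}" "u \<in> I \<times> J" "v \<in> I \<times> J" "fst u \<noteq> fst v"
      by (rule equipartite_edgeE)
    obtain x where x: "u = \<psi> x" "x \<in> carrier P"
      using uv(2) unfolding \<psi>_surj[symmetric] by (rule imageE)
    obtain y where y: "v = \<psi> y" "y \<in> carrier P"
      using uv(3) unfolding \<psi>_surj[symmetric] by (rule imageE)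
    note xy = x y
    then have "part x \<noteq> part y"
      using uv(4) by (auto simp: \<psi>_def)
    then have "{x, y} \<in> E"
      using xy E_iff by simp
    then have "\<psi> ` {x, y} \<in> map_edges \<psi> E"
      unfolding map_edges_def by (rule imageI)
    then show "e \<in> map_edges \<psi> E"
      using uv xy by simp
  qed
  define \<G> where "\<G> = map_edges \<psi> ` \<F>"
  have facG: "one_factorization (I \<times> J) (equipartite_edges I J) \<G>"
    using one_factorization_image[OF \<psi> facP sub] by (simp add: \<psi>_E \<G>_def)
  have "regular (I \<times> J) \<G>"
  proof -
    have inj: "inj_on \<psi> (carrier P)"
      using \<psi> by (rule bij_betw_imp_inj_on)
    interpret Q: group "image_group \<psi> P"
      using inj by (rule P.inj_imp_image_group_is_group)
    have cQ: "carrier (image_group \<psi> P) = I \<times> J"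
      by (simp add: image_group_carrier \<psi>_surj)
    have "translation_invariant (image_group \<psi> P) \<G>"
      unfolding \<G>_def using inj P.is_group invP
      by (rule translation_invariant_image) (use sub one_factorizationD(1)[OF facP] in blast)
    moreover have "e \<subseteq> I \<times> J" if "F \<in> \<G>" "e \<in> F" for F e
    proof -
      have "e \<in> equipartite_edges I J"
        using that one_factorizationD(1)[OF facG] by blast
      then show ?thesis
        by (auto elim: equipartite_edgeE)
    qed
    ultimately show ?thesis
      using Q.regular_translations[of \<G>] unfolding cQ by blast
  qed
  moreover have "contains_subfactorization (I \<times> J) (equipartite_edges I J) \<G> (I' \<times> J') (equipartite_edges I' J') \<H>"
    unfolding contains_subfactorization_def
  proof (intro exI conjI ballI)
    \<comment> \<open>The small graph is embedded as the layer of the identity of \<open>T\<close>.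
      The image of \<open>F\<close> then lies in the factor made of all copies of \<open>F\<close>,
      and disjointness of the factors of \<open>\<G>\<close> gives the required alternative.\<close>
    define \<phi> where "\<phi> v = \<psi> (v, \<one>\<^bsub>T\<^esub>)" for v
    have slice: "map_edges \<phi> F = map_edges \<psi> ((\<lambda>e. e \<times> {\<one>\<^bsub>T\<^esub>}) ` F)" for F
      unfolding map_edges_def image_image by (intro image_cong refl) (auto simp: \<phi>_def)
    have slice_sub: "map_edges \<phi> F \<subseteq> map_edges \<psi> (copies (carrier T) F)" for F
      unfolding slice by (auto simp: map_edges_def copies_def)
    have mem: "(v, \<one>\<^bsub>T\<^esub>) \<in> carrier P" if "v \<in> I' \<times> J'" for v
      using that by (simp add: P_def cG)
    have "inj_on \<phi> (I' \<times> J')"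
    proof (rule inj_onI)
      fix u v assume uv: "u \<in> I' \<times> J'" "v \<in> I' \<times> J'" "\<phi> u = \<phi> v"
      have "(u, \<one>\<^bsub>T\<^esub>) = (v, \<one>\<^bsub>T\<^esub>)"
        by (rule inj_onD[OF bij_betw_imp_inj_on[OF \<psi>] _ mem[OF uv(1)] mem[OF uv(2)]])
          (use uv(3) in \<open>simp add: \<phi>_def\<close>)
      then show "u = v"
        by simp
    qed
    moreover have "\<phi> ` (I' \<times> J') \<subseteq> I \<times> J"
    proof (rule image_subsetI)
      show "\<phi> v \<in> I \<times> J" if "v \<in> I' \<times> J'" for v
        using imageI[OF mem[OF that], of \<psi>] by (simp only: \<psi>_surj \<phi>_def)
    qed
    moreover have "map_edges \<phi> (equipartite_edges I' J') \<subseteq> equipartite_edges I J"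
    proof -
      have "map_edges \<psi> E1 \<subseteq> map_edges \<psi> E"
        unfolding map_edges_def using E1_sub by (rule image_mono)
      then show ?thesis
        unfolding \<psi>_E E1_def using slice_sub by (rule subset_trans[rotated])
    qed
    ultimately show "subgraph_embedding \<phi> (I' \<times> J') (equipartite_edges I' J') (I \<times> J) (equipartite_edges I J)"
      by (simp add: subgraph_embedding_def)
    fix F \<Gamma> assume "F \<in> \<H>" "\<Gamma> \<in> \<G>"
    have "map_edges \<psi> (copies (carrier T) F) \<in> \<G>"
      using \<open>F \<in> \<H>\<close> by (simp add: \<G>_def \<F>_def \<F>\<^sub>1_def)
    then have "map_edges \<psi> (copies (carrier T) F) = \<Gamma>" if "e \<in> map_edges \<phi> F" "e \<in> \<Gamma>" for e
      using one_factorizationD(3)[OF facG _ \<open>\<Gamma> \<in> \<G>\<close>] slice_sub that by blast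
    then show "map_edges \<phi> F \<subseteq> \<Gamma> \<or> map_edges \<phi> F \<inter> \<Gamma> = {}"
      using slice_sub by blast
  qed
  ultimately show ?thesis
    using facG by (auto simp: equipartite_verts_def)
qed

text \<open>Formulated for a group on the small vertex set, so that it applies both to the given
  factorization and to the trivial one on a single vertex.\<close>

lemma equipartite_extension_cardinal_dvd:
  fixes G :: "('a \<times> 'b) monoid" and I :: "'c set" and J :: "'d set"
  assumes "group G" and cG: "carrier G = I' \<times> J'"
    and "one_factorization (I' \<times> J') (equipartite_edges I' J') \<H>"
    and "translation_invariant G \<H>"
    and inf: "infinite (I \<times> J)"
    and dvd: "cardinal_dvd I' I" "cardinal_dvd J' J"
  shows "\<exists>\<G>. one_factorization (equipartite_verts I J) (equipartite_edges I J) \<G>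
           \<and> regular (equipartite_verts I J) \<G>
           \<and> contains_subfactorization (equipartite_verts I J) (equipartite_edges I J) \<G>
               (equipartite_verts I' J') (equipartite_edges I' J') \<H>"
proof -
  have ne: "I \<noteq> {}" "J \<noteq> {}"
    using inf by auto
  have "I' \<times> J' \<noteq> {}"
    using monoid.one_closed[OF group.is_monoid[OF \<open>group G\<close>]] cG by auto
  then have ne': "I' \<noteq> {}" "J' \<noteq> {}"
    by auto
  obtain A where A: "A \<noteq> {}" "I' \<times> A \<approx> I" "infinite I \<longrightarrow> A = I"
    using cardinal_dvd_cofactor[OF dvd(1) ne'(1) ne(1)] by (elim exE conjE) (rule that)
  obtain B where B: "B \<noteq> {}" "J' \<times> B \<approx> J" "infinite J \<longrightarrow> B = J"
    using cardinal_dvd_cofactor[OF dvd(2) ne'(2) ne(2)] by (elim exE conjE) (rule that)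
  have "\<exists>(K :: 'c monoid) (L :: 'd monoid). group K \<and> group L \<and> carrier K = A \<and> carrier L = B \<and>
          (I \<times> J \<lesssim> A \<and> (\<forall>k\<in>A. k \<otimes>\<^bsub>K\<^esub> k = \<one>\<^bsub>K\<^esub>) \<or>
           I \<times> J \<lesssim> B \<and> (\<forall>l\<in>B. l \<otimes>\<^bsub>L\<^esub> l = \<one>\<^bsub>L\<^esub>))"
  \<comment> \<open>The larger of \<open>I\<close> and \<open>J\<close> is infinite and as large as
    \<open>I \<times> J\<close>. It is its own cofactor and receives the group of exponent 2; the
    other cofactor may be finite and takes any group.\<close>
  proof (cases "|J| \<le>o |I|")
    case True
    then have "infinite I"
      using inf card_of_ordLeq_finite by auto
    then have AI: "infinite A" "A = I"
      using A(3) by simp_all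
    then have "I \<times> J \<approx> A"
      using card_of_Times_infinite_simps(1)[OF \<open>infinite I\<close> ne(2) True]
      by (simp only: eqpoll_iff_card_of_ordIso)
    then have IJ: "I \<times> J \<lesssim> A"
      by (rule eqpoll_imp_lepoll)
    obtain K :: "'c monoid" where K: "group K" "carrier K = A" "\<forall>k\<in>A. k \<otimes>\<^bsub>K\<^esub> k = \<one>\<^bsub>K\<^esub>"
      using exponent_2_group_exists[OF AI(1)] by blast
    obtain L :: "'d monoid" where L: "group L" "carrier L = B"
      using group_exists[OF B(1)] by blast
    show ?thesis
      by (intro exI[of _ K] exI[of _ L] conjI disjI1 IJ K L)
  next
    case False
    then have "|I| \<le>o |J|"
      by (simp add: ordLess_imp_ordLeq)
    then have "infinite J"
      using inf card_of_ordLeq_finite by auto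
    then have BJ: "infinite B" "B = J"
      using B(3) by simp_all
    then have "I \<times> J \<approx> B"
      using card_of_Times_infinite_simps(3)[OF \<open>infinite J\<close> ne(1) \<open>|I| \<le>o |J|\<close>]
      by (simp only: eqpoll_iff_card_of_ordIso)
    then have IJ: "I \<times> J \<lesssim> B"
      by (rule eqpoll_imp_lepoll)
    obtain L :: "'d monoid" where L: "group L" "carrier L = B" "\<forall>l\<in>B. l \<otimes>\<^bsub>L\<^esub> l = \<one>\<^bsub>L\<^esub>"
      using exponent_2_group_exists[OF BJ(1)] by blast
    obtain K :: "'c monoid" where K: "group K" "carrier K = A"
      using group_exists[OF A(1)] by blast
    show ?thesis
      by (intro exI[of _ K] exI[of _ L] conjI disjI2 IJ K L)
  qed
  then obtain K :: "'c monoid" and L :: "'d monoid" where KL: "group K" "group L" and KL_carrier: "carrier K = A" "carrier L = B"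
    and big:
      "I \<times> J \<lesssim> A \<and> (\<forall>k\<in>A. k \<otimes>\<^bsub>K\<^esub> k = \<one>\<^bsub>K\<^esub>) \<or>
       I \<times> J \<lesssim> B \<and> (\<forall>l\<in>B. l \<otimes>\<^bsub>L\<^esub> l = \<one>\<^bsub>L\<^esub>)"
    by blast
  obtain p q where "bij_betw p (I' \<times> carrier K) I" "bij_betw q (J' \<times> carrier L) J"
    using A(2) B(2) unfolding KL_carrier eqpoll_def by blast
  then show ?thesis
    using big unfolding KL_carrier[symmetric]
    by (intro equipartite_extension[OF assms(1) KL assms(2-4) _ _ inf])
qed

theorem theorem5p2:
  fixes I' :: "'a set" and J' :: "'b set" and I :: "'c set" and J :: "'d set"
    and H :: "('h, 'e) monoid_scheme" and \<H> :: "('a \<times> 'b) set set set"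
  assumes "group H"
    and "one_factorization (equipartite_verts I' J') (equipartite_edges I' J') \<H>"
    and "group_regular H (equipartite_verts I' J') \<H>"
    and "infinite (I \<times> J)"
    and "cardinal_dvd I' I"
    and "cardinal_dvd J' J"
  shows "\<exists>\<G>. one_factorization (equipartite_verts I J) (equipartite_edges I J) \<G>
           \<and> regular (equipartite_verts I J) \<G>
           \<and> contains_subfactorization (equipartite_verts I J) (equipartite_edges I J) \<G>
               (equipartite_verts I' J') (equipartite_edges I' J') \<H>"
proof (cases "I' \<times> J' = {}")
  case True
  \<comment> \<open>\<open>K\<^sub>m\<^sub>'[n']\<close> has no vertices, so it may be replaced by \<open>K\<^sub>1[1]\<close>.\<close>
  then have "equipartite_edges I' J' = {}"
    by (auto simp: equipartite_edges_def)
  then have "\<H> = {}"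
    using assms(2) by (auto simp: one_factorization_def partition_on_def)
  obtain i j where ij: "i \<in> I" "j \<in> J"
    using assms(4) by fastforce
  have single: "cardinal_dvd {x} X" if "x \<in> X" for x :: 'x and X
    using that by (auto simp: cardinal_dvd_def intro: subset_imp_lepoll)
  obtain G :: "('c \<times> 'd) monoid" where "group G" "carrier G = {i} \<times> {j}"
    using group_exists[of "{i} \<times> {j}"] by auto
  \<comment> \<open>With no edges, the empty family is a partition of the edge set, and it contains
    no factor that would have to cover the vertex.\<close>
  moreover have "one_factorization ({i} \<times> {j}) (equipartite_edges {i} {j}) {}"
    by (auto simp: one_factorization_def equipartite_edges_def partition_on_def)
  moreover have "translation_invariant G {}"
    by (simp add: translation_invariant_def)
  ultimately obtain \<G> where "one_factorization (equipartite_verts I J) (equipartite_edges I J) \<G>"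
      "regular (equipartite_verts I J) \<G>"
    using equipartite_extension_cardinal_dvd[OF _ _ _ _ assms(4) single[OF ij(1)] single[OF ij(2)]] by blast
  moreover have "contains_subfactorization (equipartite_verts I J) (equipartite_edges I J) \<G>
      (equipartite_verts I' J') (equipartite_edges I' J') \<H>"
    unfolding contains_subfactorization_def subgraph_embedding_def equipartite_verts_def map_edges_def
      True \<open>\<H> = {}\<close> \<open>equipartite_edges I' J' = {}\<close> by simp
  ultimately show ?thesis
    by blast
next
  case False
  have fac: "one_factorization (I' \<times> J') (equipartite_edges I' J') \<H>"
    using assms(2) by (simp add: equipartite_verts_def)
  have "e \<subseteq> I' \<times> J'" if "F \<in> \<H>" "e \<in> F" for F e
  proof -
    have "e \<in> equipartite_edges I' J'"
      using one_factorizationD(1)[OF fac] that by blast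
    then show ?thesis
      by (auto elim: equipartite_edgeE)
  qed
  then obtain G :: "('a \<times> 'b) monoid" where
      "group G" "carrier G = I' \<times> J'" "translation_invariant G \<H>"
    using group_regular_imp_translations[OF assms(3)[unfolded equipartite_verts_def] False] by blast
  then show ?thesis
    by (intro equipartite_extension_cardinal_dvd fac assms(4-6))
qed

end
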